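(* In the RapDual setting below, let the inner iteration number be $s=\lceil-\log\widehat{\mathcal M}/\log\alpha\rceil$ with $\widehat{\mathcal M}=(2+\frac L\mu)\max\{2,\frac{L^2}{\mu^2}\}$. Let $(\bar{\mathbf x}^\ell,\bar x_m^\ell)$, $\ell=1,\dots,k$, be generated by RapDual, $\hat\ell$ be uniformly distributed on $\{1,\dots,k\}$ independent of everything else, and $\mathcal D^0:=f(\bar{\mathbf x}^0)+f_m(\bar x_m^0)-[f(\mathbf x^* )+f_m(x_m^* )]$. Then there exists a (random) vector $\lambda^*\in\mathbb{R}^n$ such that $$\mathbb{E}\big[d\big(\nabla f(\mathbf x_*^{\hat\ell})+\mathbf A^\top\lambda^*,-N_X(\mathbf x_*^{\hat\ell})\big)\big]^2\le\frac{8\mu}{k}\mathcal D^0,\qquad \mathbb{E}\|\nabla f_m(\bar x_m^{\hat\ell})+\lambda^*\|^2\le\frac{34\mu}{k}\mathcal D^0,$$ $$\mathbb{E}\|\bar{\mathbf x}^{\hat\ell}-\mathbf x_*^{\hat\ell}\|^2\le\frac{2\mu}{kL^2}\mathcal D^0,\qquad \mathbb{E}\|\mathbf A\bar{\mathbf x}^{\hat\ell}+\bar x_m^{\hat\ell}-\mathbf b\|^2\le\frac{2(\|\mathbf A\|^2+1)\mu}{kL^2}\mathcal D^0.$$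
   Context: RapDual setting. Let $m\ge3$, $X_i\subseteq\mathbb{R}^{d_i}$ ($i=1,\dots,m-1$) nonempty closed convex sets, $X=X_1\times\dots\times X_{m-1}$, $\mathbf x=(x_1,\dots,x_{m-1})$, $\mathbf A_i\in\mathbb{R}^{n\times d_i}$, $\mathbf A=[\mathbf A_1,\dots,\mathbf A_{m-1}]$, $\mathbf b\in\mathbb{R}^n$, $\bar A=\max_{i\in[m-1]}\|\mathbf A_i\|$ (operator norm). Let $0<\mu\le L$. Functions $f_i:X_i\to\mathbb{R}$ ($i<m$) and $f_m:\mathbb{R}^n\to\mathbb{R}$ are differentiable with $f_i(x)-f_i(y)-\langle\nabla f_i(y),x-y\rangle\ge-\frac\mu2\|x-y\|^2$ for all $i=1,\dots,m$, and $\nabla f_m$ is $L$-Lipschitz. Let $f(\mathbf x)=\sum_{i=1}^{m-1}f_i(x_i)$. Problem: $\min\{f(\mathbf x)+f_m(x_m):\mathbf x\in X,x_m\in\mathbb{R}^n,\mathbf A\mathbf x+x_m=\mathbf b\}$ with an optimal solution $(\mathbf x^*,x_m^* )$ (assumed to exist). Let $\hat L=L+2\mu$, $c=\hat L\bar A^2/\mu$, $\alpha=1-\frac{2}{(m-1)(\sqrt{1+8c}+1)}$, and for all $t$: $\alpha_t=(m-1)\alpha$, $\gamma_t=\alpha^{-t}$, $\tau_t=\frac{\alpha}{1-\alpha}$, $\eta_t=\frac{(\alpha-\frac{m-2}{m-1})\mu}{1-\alpha}$. Inner method RaDual for $\min\{\psi(\mathbf x)+\psi_m(x_m):\mathbf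 x\in X,\mathbf A\mathbf x+x_m=\mathbf b\}$, $\psi(\mathbf x)=\sum_{i<m}\psi_i(x_i)$, with inputs $\mathbf x^{-1}=\mathbf x^0\in X$, $x_m^0$, iteration number $s$: set $g^0=-x_m^0$; for $t=1,\dots,s$ draw $i_t$ uniformly from $\{1,\dots,m-1\}$ independently of the past; $\tilde{\mathbf x}^t=\alpha_t(\mathbf x^{t-1}-\mathbf x^{t-2})+\mathbf x^{t-1}$; $g^t=(\tau_tg^{t-1}+\mathbf A\tilde{\mathbf x}^t-\mathbf b)/(1+\tau_t)$; $y^t=-\nabla\psi_m(-g^t)$; $x_i^t=\arg\min_{x_i\in X_i}\{\psi_i(x_i)+\langle\mathbf A_i^\top y^t,x_i\rangle+\frac{\eta_t}{2}\|x_i-x_i^{t-1}\|^2\}$ if $i=i_t$, else $x_i^t=x_i^{t-1}$; output $\mathbf x^s$ and $x_m^s=\arg\min_{x_m}\{\psi_m(x_m)+\langle x_m,y^s\rangle\}$. RapDual: choose $\bar{\mathbf x}^0\in X$, $\bar x_m^0\in\mathbb{R}^n$ with $\mathbf A\bar{\mathbf x}^0+\bar x_m^0=\mathbf b$. For $\ell=1,\dots,k$: let $\psi_i(x_i)=f_i(x_i)+\mu\|x_i-\bar x_i^{\ell-1}\|^2$ (so $\psi=\psi^\ell(\mathbf x)=f(\mathbf x)+\mu\|\mathbf x-\bar{\mathbf x}^{\ell-1}\|^2$) and $\psi_m=\psi_m^\ell(x_m)=f_m(x_m)+\mu\|x_m-\bar x_m^{\ell-1}\|^2$; run RaDual (fresh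 independent indices) with inputs $\mathbf x^{-1}=\mathbf x^0=\bar{\mathbf x}^{\ell-1}$, $x_m^0=\bar x_m^{\ell-1}$ and $s$ iterations; set $(\bar{\mathbf x}^\ell,\bar x_m^\ell)=(\mathbf x^s,x_m^s)$. $(\mathbf x_*^\ell,x_{m*}^\ell)$ denotes the optimal solution of the $\ell$-th subproblem $\min\{\psi^\ell(\mathbf x)+\psi_m^\ell(x_m):\mathbf x\in X,\mathbf A\mathbf x+x_m=\mathbf b\}$. $\mathbb{E}$ is expectation over all randomness. $d(u,Z):=\inf_{z\in Z}\|u-z\|$; $N_X(\hat{\mathbf x}):=\{v:\langle v,\mathbf y-\hat{\mathbf x}\rangle\le0\ \forall\mathbf y\in X\}$ is the normal cone; $\|\mathbf A\|$ is the operator norm. *)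

theory Defs
  imports "HOL-Probability.Probability"
begin

text \<open>Block structure. The variable x = (x_1,...,x_{m-1}) lives in the Euclidean space 'a
  (= R^{d_1+...+d_{m-1}}); block i (i = 1..m-1) is the coordinate subspace spanned by the
  basis vectors in B i (so R^{d_i} = span (B i), d_i = card (B i)).
  x_i corresponds to blk (B i) x.\<close>

definition blk :: "'a::euclidean_space set \<Rightarrow> 'a \<Rightarrow> 'a" where
  "blk S x = (\<Sum>b\<in>S. (x \<bullet> b) *\<^sub>R b)"

definition upd_blk :: "'a::euclidean_space set \<Rightarrow> 'a \<Rightarrow> 'a \<Rightarrow> 'a" where
  "upd_blk S x v = x - blk S x + v"

definition prodX :: "nat \<Rightarrow> (nat \<Rightarrow> 'a::euclidean_space set) \<Rightarrow> (nat \<Rightarrow> 'a set) \<Rightarrow> 'a set" where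
  "prodX m B Xs = {x. \<forall>i\<in>{1..m-1}. blk (B i) x \<in> Xs i}"

text \<open>f(x) = sum_i f_i(x_i) and its gradient (\<nabla>f_1(x_1),...,\<nabla>f_{m-1}(x_{m-1})).\<close>
definition fsum :: "nat \<Rightarrow> (nat \<Rightarrow> 'a::euclidean_space set) \<Rightarrow> (nat \<Rightarrow> 'a \<Rightarrow> real) \<Rightarrow> 'a \<Rightarrow> real" where
  "fsum m B f x = (\<Sum>i=1..m-1. f i (blk (B i) x))"

definition gsum :: "nat \<Rightarrow> (nat \<Rightarrow> 'a::euclidean_space set) \<Rightarrow> (nat \<Rightarrow> 'a \<Rightarrow> 'a) \<Rightarrow> 'a \<Rightarrow> 'a" where
  "gsum m B gf x = (\<Sum>i=1..m-1. gf i (blk (B i) x))"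

definition normal_cone :: "'a::real_inner set \<Rightarrow> 'a \<Rightarrow> 'a set" where
  "normal_cone X x = {v. \<forall>y\<in>X. v \<bullet> (y - x) \<le> 0}"

definition Abar :: "nat \<Rightarrow> (nat \<Rightarrow> 'a::euclidean_space set) \<Rightarrow> ('a \<Rightarrow> 'b::euclidean_space) \<Rightarrow> real" where
  "Abar m B A = Max ((\<lambda>i. onorm (\<lambda>x. A (blk (B i) x))) ` {1..m-1})"

definition rap_alpha :: "nat \<Rightarrow> real \<Rightarrow> real \<Rightarrow> real \<Rightarrow> real" where
  "rap_alpha m mu L Ab =
     (let c = (L + 2*mu) * Ab\<^sup>2 / mu in 1 - 2 / ((real m - 1) * (sqrt (1 + 8*c) + 1)))"

definition rap_tau :: "real \<Rightarrow> real" where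
  "rap_tau \<alpha> = \<alpha> / (1 - \<alpha>)"

definition rap_eta :: "nat \<Rightarrow> real \<Rightarrow> real \<Rightarrow> real" where
  "rap_eta m mu \<alpha> = (\<alpha> - (real m - 2) / (real m - 1)) * mu / (1 - \<alpha>)"

definition rap_s :: "real \<Rightarrow> real \<Rightarrow> real \<Rightarrow> nat" where
  "rap_s mu L \<alpha> = nat \<lceil>- ln ((2 + L/mu) * max 2 (L\<^sup>2/mu\<^sup>2)) / ln \<alpha>\<rceil>"

text \<open>RaDual applied to the l-th RapDual subproblem with prox-centre (xb, xbm):
  psi_i(v) = f_i(v) + mu \<parallel>v - xb_i\<parallel>^2, psi_m(u) = f_m(u) + mu \<parallel>u - xbm\<parallel>^2,
  grad psi_m(u) = grad f_m(u) + 2 mu (u - xbm).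
  Inputs x^{-1} = x^0 = xb, x_m^0 = xbm. idx t = i_t.
  State after t steps: (x^t, x^{t-1}, g^t, y^t) (y^0 is a dummy 0).\<close>
fun radual ::
  "nat \<Rightarrow> (nat \<Rightarrow> 'a::euclidean_space set) \<Rightarrow> (nat \<Rightarrow> 'a set) \<Rightarrow> ('a \<Rightarrow> 'b::euclidean_space) \<Rightarrow> 'b
   \<Rightarrow> (nat \<Rightarrow> 'a \<Rightarrow> real) \<Rightarrow> ('b \<Rightarrow> 'b) \<Rightarrow> real \<Rightarrow> real \<Rightarrow> real \<Rightarrow> real
   \<Rightarrow> 'a \<Rightarrow> 'b \<Rightarrow> (nat \<Rightarrow> nat) \<Rightarrow> nat \<Rightarrow> 'a \<times> 'a \<times> 'b \<times> 'b" where
  "radual m B Xs A bv f gfm mu \<alpha>t \<tau> \<eta> xb xbm idx 0 = (xb, xb, - xbm, 0)"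
| "radual m B Xs A bv f gfm mu \<alpha>t \<tau> \<eta> xb xbm idx (Suc t) =
     (let (x1, x2, g, _) = radual m B Xs A bv f gfm mu \<alpha>t \<tau> \<eta> xb xbm idx t;
          xt = \<alpha>t *\<^sub>R (x1 - x2) + x1;
          g' = (1 / (1 + \<tau>)) *\<^sub>R (\<tau> *\<^sub>R g + A xt - bv);
          y = - (gfm (- g') + (2 * mu) *\<^sub>R (- g' - xbm));
          i = idx (Suc t);
          obj = (\<lambda>v. f i v + mu * (norm (v - blk (B i) xb))\<^sup>2 + y \<bullet> A v
                     + \<eta> / 2 * (norm (v - blk (B i) x1))\<^sup>2);
          v = (SOME v. v \<in> Xs i \<and> (\<forall>w\<in>Xs i. obj v \<le> obj w))
      in (upd_blk (B i) x1 v, x1, g', y))"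

definition radual_out ::
  "nat \<Rightarrow> (nat \<Rightarrow> 'a::euclidean_space set) \<Rightarrow> (nat \<Rightarrow> 'a set) \<Rightarrow> ('a \<Rightarrow> 'b::euclidean_space) \<Rightarrow> 'b
   \<Rightarrow> (nat \<Rightarrow> 'a \<Rightarrow> real) \<Rightarrow> ('b \<Rightarrow> real) \<Rightarrow> ('b \<Rightarrow> 'b) \<Rightarrow> real \<Rightarrow> real \<Rightarrow> real \<Rightarrow> real
   \<Rightarrow> 'a \<Rightarrow> 'b \<Rightarrow> (nat \<Rightarrow> nat) \<Rightarrow> nat \<Rightarrow> 'a \<times> 'b" where
  "radual_out m B Xs A bv f fm gfm mu \<alpha>t \<tau> \<eta> xb xbm idx s =
     (let (xs, _, _, y) = radual m B Xs A bv f gfm mu \<alpha>t \<tau> \<eta> xb xbm idx s;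
          obj = (\<lambda>u. fm u + mu * (norm (u - xbm))\<^sup>2 + u \<bullet> y)
      in (xs, SOME u. \<forall>w. obj u \<le> obj w))"

text \<open>RapDual: \<omega> (l, t) is the index i_t drawn in the t-th inner iteration of the l-th outer
  iteration. Returns (\<bar>x^l, \<bar>x_m^l).\<close>
fun rapdual ::
  "nat \<Rightarrow> (nat \<Rightarrow> 'a::euclidean_space set) \<Rightarrow> (nat \<Rightarrow> 'a set) \<Rightarrow> ('a \<Rightarrow> 'b::euclidean_space) \<Rightarrow> 'b
   \<Rightarrow> (nat \<Rightarrow> 'a \<Rightarrow> real) \<Rightarrow> ('b \<Rightarrow> real) \<Rightarrow> ('b \<Rightarrow> 'b) \<Rightarrow> real \<Rightarrow> real \<Rightarrow> real \<Rightarrow> real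
   \<Rightarrow> nat \<Rightarrow> 'a \<Rightarrow> 'b \<Rightarrow> (nat \<times> nat \<Rightarrow> nat) \<Rightarrow> nat \<Rightarrow> 'a \<times> 'b" where
  "rapdual m B Xs A bv f fm gfm mu \<alpha>t \<tau> \<eta> s x0 xm0 \<omega> 0 = (x0, xm0)"
| "rapdual m B Xs A bv f fm gfm mu \<alpha>t \<tau> \<eta> s x0 xm0 \<omega> (Suc l) =
     (let (xb, xbm) = rapdual m B Xs A bv f fm gfm mu \<alpha>t \<tau> \<eta> s x0 xm0 \<omega> l
      in radual_out m B Xs A bv f fm gfm mu \<alpha>t \<tau> \<eta> xb xbm (\<lambda>t. \<omega> (Suc l, t)) s)"

definition sub_opt ::
  "nat \<Rightarrow> (nat \<Rightarrow> 'a::euclidean_space set) \<Rightarrow> (nat \<Rightarrow> 'a set) \<Rightarrow> ('a \<Rightarrow> 'b::euclidean_space) \<Rightarrow> 'b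
   \<Rightarrow> (nat \<Rightarrow> 'a \<Rightarrow> real) \<Rightarrow> ('b \<Rightarrow> real) \<Rightarrow> real \<Rightarrow> 'a \<Rightarrow> 'b \<Rightarrow> 'a \<times> 'b" where
  "sub_opt m B Xs A bv f fm mu xb xbm =
     (let obj = (\<lambda>x xm. fsum m B f x + mu * (norm (x - xb))\<^sup>2 + fm xm + mu * (norm (xm - xbm))\<^sup>2)
      in SOME (x, xm). x \<in> prodX m B Xs \<and> A x + xm = bv \<and>
           (\<forall>x'\<in>prodX m B Xs. \<forall>xm'. A x' + xm' = bv \<longrightarrow> obj x xm \<le> obj x' xm'))"

end

theory Submission
  imports Defs
begin

text \<open>The Bregman distance of \<open>\<psi>\<^sub>m\<close> turns the dual update into an exact three-point identity once the dual
  iterate \<open>u = - g\<close> is replaced by its extrapolation \<open>uh\<^sup>t = u\<^sup>t - (1 - \<alpha>) (m - 1) A (x\<^sup>t - x\<^sup>t\<^sup>-\<^sup>1)\<close>, because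
  \<open>u\<^sup>t\<^sup>+\<^sup>1\<close> is then a convex combination of \<open>uh\<^sup>t\<close> and \<open>b - A x\<^sup>t\<close>. Adding the growth inequality of the block
  proximal steps, the coupling terms cancel in expectation. Passing from \<open>uh\<^sup>s\<close> back to the
  actual iterate \<open>u\<^sup>s\<close> at the last step costs a factor \<open>1 + q\<close> with \<open>q = \<mu> / (L + 2\<mu>)\<close>; the dissipation of the
  Bregman distance along the \<open>s\<close> steps makes up for this factor, so that one run of RaDual contracts the
  expected squared distance to the solution of the subproblem by \<open>1 / max 2 (L\<^sup>2 / \<mu>\<^sup>2)\<close>.

  The solution of one subproblem is feasible for the next one, hence the objective values at these
  solutions telescope, and the contraction factor being at most 1/2 leaves a bound for the sum of the
  squared distances between proximal centres and subproblem solutions. The multiplier is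
  \<open>- \<nabla>\<psi>\<^sub>m\<close> at the solution of the subproblem.\<close>

section \<open>Strongly convex functions and blocks\<close>

text \<open>At a point p of the segment between v and w, the lower bounds towards w and towards v
  are averaged with weights 1 - t and t, so that the slope \<open>g p\<close> cancels; minimality
  gives \<open>h v \<le> h p\<close>. Letting t tend to 1 recovers the full constant c / 2. Any
  slope map with the quadratic lower bound qualifies, so functions differentiable only inside a
  block subspace are covered.\<close>

lemma strongly_convex_min_growth:
  fixes h :: "'a::real_inner \<Rightarrow> real"
  assumes "convex S"
    and lb: "\<And>x y. x \<in> S \<Longrightarrow> y \<in> S \<Longrightarrow> h y + g y \<bullet> (x - y) + c / 2 * (norm (x - y))\<^sup>2 \<le> h x"
    and v: "v \<in> S" "\<And>w. w \<in> S \<Longrightarrow> h v \<le> h w" and w: "w \<in> S"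
  shows "h v + c / 2 * (norm (w - v))\<^sup>2 \<le> h w"
proof -
  have "t * (c / 2 * (norm (w - v))\<^sup>2) \<le> h w - h v" if t: "0 < t" "t < 1" for t
  proof -
    define p where "p = w + t *\<^sub>R (v - w)"
    have "p = t *\<^sub>R v + (1 - t) *\<^sub>R w" by (simp add: p_def algebra_simps)
    then have pS: "p \<in> S" using convexD[OF \<open>convex S\<close> v(1) w, of t "1 - t"] t by simp
    have wp: "w - p = t *\<^sub>R (w - v)" and vp: "v - p = (- (1 - t)) *\<^sub>R (w - v)"
      by (simp_all add: p_def algebra_simps)
    have "h p + t * (g p \<bullet> (w - v)) + c / 2 * (t\<^sup>2 * (norm (w - v))\<^sup>2) \<le> h w"
      using lb[OF w pS] unfolding wp by (simp add: power_mult_distrib)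
    then have 1: "(1 - t) * (h p + t * (g p \<bullet> (w - v)) + c / 2 * (t\<^sup>2 * (norm (w - v))\<^sup>2)) \<le> (1 - t) * h w"
      using t by (intro mult_left_mono) auto
    have "h p - (1 - t) * (g p \<bullet> (w - v)) + c / 2 * ((1 - t)\<^sup>2 * (norm (w - v))\<^sup>2) \<le> h v"
    proof -
      have "g p \<bullet> (v - p) = - ((1 - t) * (g p \<bullet> (w - v)))"
        unfolding vp inner_scaleR_right by (rule mult_minus_left)
      moreover have "(norm (v - p))\<^sup>2 = (1 - t)\<^sup>2 * (norm (w - v))\<^sup>2"
        using t unfolding vp by (simp add: power_mult_distrib)
      ultimately show ?thesis using lb[OF v(1) pS] by simp
    qed
    then have 2: "t * (h p - (1 - t) * (g p \<bullet> (w - v)) + c / 2 * ((1 - t)\<^sup>2 * (norm (w - v))\<^sup>2)) \<le> t * h v"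
      using t by (intro mult_left_mono) auto
    have "h v \<le> h p" by (rule v(2)[OF pS])
    have "(1 - t) * (t * (c / 2 * (norm (w - v))\<^sup>2)) \<le> (1 - t) * (h w - h v)"
    proof -
      have "(1 - t) * (H + t * a + c / 2 * (t\<^sup>2 * n)) + t * (H - (1 - t) * a + c / 2 * ((1 - t)\<^sup>2 * n))
          = H + (1 - t) * (t * (c / 2 * n))" for H a n :: real
        by (simp add: power2_eq_square field_simps)
      from this[of "h p" "g p \<bullet> (w - v)" "(norm (w - v))\<^sup>2"] 1 2 \<open>h v \<le> h p\<close>
      have "h v + (1 - t) * (t * (c / 2 * (norm (w - v))\<^sup>2)) \<le> (1 - t) * h w + t * h v" by linarith
      moreover have "(1 - t) * (h w - h v) = (1 - t) * h w + t * h v - h v"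
        by (simp add: algebra_simps)
      ultimately show ?thesis by linarith
    qed
    then show ?thesis using t by simp
  qed
  then have "c / 2 * (norm (w - v))\<^sup>2 \<le> h w - h v" by (rule field_le_mult_one_interval)
  then show ?thesis by simp
qed

text \<open>A quadratic minorant at the single point \<open>y\<close> makes \<open>h\<close>
  coercive: outside a large ball it exceeds \<open>h y\<close>, so a minimiser over the compact part
  is global.\<close>

lemma strongly_convex_attains_min:
  fixes h :: "'a::euclidean_space \<Rightarrow> real"
  assumes "closed S" "y \<in> S" "continuous_on S h" "0 < c"
    and lb: "\<And>x. x \<in> S \<Longrightarrow> C + G \<bullet> (x - y) + c / 2 * (norm (x - y))\<^sup>2 \<le> h x"
  shows "\<exists>v\<in>S. \<forall>w\<in>S. h v \<le> h w"
proof -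
  \<comment> \<open>Beyond this radius c / 2 * r - norm G is at least \<bar>h y - C\<bar> + 1. The
    final summand 1 gives r \<ge> 1, so the bound survives multiplication by r.\<close>
  define R where "R = 2 * (norm G + \<bar>h y - C\<bar> + 1) / c + 1"
  have "compact (S \<inter> cball y R)" using \<open>closed S\<close> by (simp add: closed_Int_compact)
  moreover have "R \<ge> 1" using \<open>0 < c\<close> by (simp add: R_def)
  then have "y \<in> S \<inter> cball y R" using assms(2) by simp
  moreover have "continuous_on (S \<inter> cball y R) h" using assms(3) continuous_on_subset by blast
  ultimately obtain v where v: "v \<in> S \<inter> cball y R" "\<forall>w\<in>S \<inter> cball y R. h v \<le> h w"
    using continuous_attains_inf[of "S \<inter> cball y R" h] by blast
  have "h v \<le> h w" if w: "w \<in> S" for w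
  proof (cases "w \<in> cball y R")
    case True then show ?thesis using v w by blast
  next
    case False
    define r where "r = norm (w - y)"
    have r: "R < r" "1 \<le> r" using False \<open>R \<ge> 1\<close> by (auto simp: r_def dist_norm norm_minus_commute)
    have "2 * (norm G + \<bar>h y - C\<bar> + 1) / c \<le> r" using r by (simp add: R_def)
    then have k: "\<bar>h y - C\<bar> + 1 \<le> c / 2 * r - norm G"
      using \<open>0 < c\<close> by (simp add: field_simps)
    have "1 * (\<bar>h y - C\<bar> + 1) \<le> r * (c / 2 * r - norm G)"
      by (intro mult_mono k r(2)) (use r in auto)
    moreover have "- (norm G * r) \<le> G \<bullet> (w - y)"
      using Cauchy_Schwarz_ineq2[of G "w - y"] by (simp add: r_def)
    ultimately have "h y \<le> C + G \<bullet> (w - y) + c / 2 * r\<^sup>2"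
      using abs_ge_self[of "h y - C"] by (simp add: algebra_simps power2_eq_square)
    then have "h y \<le> h w" using lb[OF w] by (simp add: r_def)
    moreover have "h v \<le> h y" using v \<open>y \<in> S \<inter> cball y R\<close> by blast
    ultimately show ?thesis by simp
  qed
  then show ?thesis using v by blast
qed

text \<open>A negative slope at v towards w would make \<open>h\<close> smaller at nearby points of
  the segment, all of which lie in \<open>S\<close>.\<close>

lemma convex_min_derivative_nonneg:
  fixes h :: "'a::real_normed_vector \<Rightarrow> real"
  assumes "convex S" "v \<in> S" and min: "\<And>w. w \<in> S \<Longrightarrow> h v \<le> h w"
    and der: "(h has_derivative h') (at v)" and w: "w \<in> S"
  shows "0 \<le> h' (w - v)"
proof (rule ccontr)
  assume "\<not> 0 \<le> h' (w - v)"
  then have neg: "h' (w - v) < 0" by simp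
  let ?\<phi> = "\<lambda>t::real. v + t *\<^sub>R (w - v)"
  have "((\<lambda>t. h (?\<phi> t)) has_derivative (\<lambda>t. h' (t *\<^sub>R (w - v)))) (at 0)"
    using der by (intro has_derivative_compose[of ?\<phi> "\<lambda>t. t *\<^sub>R (w - v)" 0 UNIV h h'])
      (auto intro!: derivative_eq_intros)
  then have "((\<lambda>t. h (?\<phi> t)) has_real_derivative h' (w - v)) (at 0)"
    using der by (simp add: has_field_derivative_def has_derivative_linear linear_cmul mult.commute[of _ "h' (w - v)"])
  from DERIV_neg_dec_right[OF this neg] obtain d
    where d: "0 < d" "\<And>t. 0 < t \<Longrightarrow> t < d \<Longrightarrow> h (?\<phi> t) < h v" by auto
  define t where "t = min (d / 2) 1"
  have t: "0 < t" "t < d" "t \<le> 1" using d by (auto simp: t_def)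
  have "?\<phi> t = (1 - t) *\<^sub>R v + t *\<^sub>R w" by (simp add: algebra_simps)
  then have "?\<phi> t \<in> S" using convexD[OF \<open>convex S\<close> \<open>v \<in> S\<close> w, of "1 - t" t] t by simp
  then show False using min d(2)[OF t(1,2)] by fastforce
qed

text \<open>Along the segment from y to x, the difference of the two sides has nonpositive
  derivative, by Cauchy-Schwarz and the Lipschitz bound.\<close>

lemma lipschitz_gradient_upper_bound:
  fixes h :: "'a::real_inner \<Rightarrow> real"
  assumes der: "\<And>x. (h has_derivative (\<lambda>d. g x \<bullet> d)) (at x)"
    and lip: "\<And>x y. norm (g x - g y) \<le> L * norm (x - y)"
  shows "h x \<le> h y + g y \<bullet> (x - y) + L / 2 * (norm (x - y))\<^sup>2"
proof -
  define d where "d = x - y"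
  let ?\<phi> = "\<lambda>t. h (y + t *\<^sub>R d) - t * (g y \<bullet> d) - L / 2 * t\<^sup>2 * (norm d)\<^sup>2"
  have "?\<phi> 1 \<le> ?\<phi> 0"
  proof (rule DERIV_nonpos_imp_nonincreasing[of 0 1 ?\<phi>])
    fix t :: real assume t: "0 \<le> t" "t \<le> 1"
    have "((\<lambda>t. h (y + t *\<^sub>R d)) has_derivative (\<lambda>u. g (y + t *\<^sub>R d) \<bullet> (u *\<^sub>R d))) (at t)"
      by (rule has_derivative_compose[of "\<lambda>t. y + t *\<^sub>R d" "\<lambda>u. u *\<^sub>R d" t UNIV h, OF _ der])
        (auto intro!: derivative_eq_intros)
    then have 1: "((\<lambda>t. h (y + t *\<^sub>R d)) has_real_derivative g (y + t *\<^sub>R d) \<bullet> d) (at t)"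
      by (simp add: has_field_derivative_def mult.commute[of _ "g (y + t *\<^sub>R d) \<bullet> d"])
    have "(?\<phi> has_real_derivative g (y + t *\<^sub>R d) \<bullet> d - g y \<bullet> d - L * t * (norm d)\<^sup>2) (at t)"
      by (rule derivative_eq_intros 1 refl)+ simp
    moreover have "g (y + t *\<^sub>R d) \<bullet> d - g y \<bullet> d \<le> L * t * (norm d)\<^sup>2"
    proof -
      have "(g (y + t *\<^sub>R d) - g y) \<bullet> d \<le> norm (g (y + t *\<^sub>R d) - g y) * norm d"
        by (rule norm_cauchy_schwarz)
      also have "\<dots> \<le> (L * norm (t *\<^sub>R d)) * norm d"
        using lip[of "y + t *\<^sub>R d" y] by (intro mult_right_mono) auto
      finally show ?thesis using t by (simp add: inner_diff_left power2_eq_square mult.assoc)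
    qed
    ultimately show "\<exists>l. (?\<phi> has_real_derivative l) (at t) \<and> l \<le> 0" by fastforce
  qed simp
  then show ?thesis by (simp add: d_def)
qed

text \<open>Finite substitute for conditioning on the past: redrawing one coordinate uniformly
  leaves the average unchanged. Exchanging the new value with the old one is an involution on
  pairs.\<close>

lemma sum_PiE_resample:
  fixes G :: "('i \<Rightarrow> 'k) \<Rightarrow> real"
  assumes "finite I" "finite K" "j \<in> I"
  shows "(\<Sum>\<omega>\<in>(I \<rightarrow>\<^sub>E K). \<Sum>i\<in>K. G (fun_upd \<omega> j i)) = card K * (\<Sum>\<omega>\<in>(I \<rightarrow>\<^sub>E K). G \<omega>)"
proof -
  let ?\<Omega> = "I \<rightarrow>\<^sub>E K"
  have "(\<Sum>\<omega>\<in>?\<Omega>. \<Sum>i\<in>K. G (fun_upd \<omega> j i)) = (\<Sum>(\<omega>, i)\<in>?\<Omega> \<times> K. G (fun_upd \<omega> j i))"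
    by (simp add: sum.cartesian_product)
  also have "\<dots> = (\<Sum>(\<omega>, i)\<in>?\<Omega> \<times> K. G \<omega>)"
    by (rule sum.reindex_bij_witness[where i = "\<lambda>(\<omega>, i). (fun_upd \<omega> j i, \<omega> j)" and j = "\<lambda>(\<omega>, i). (fun_upd \<omega> j i, \<omega> j)"])
      (use \<open>j \<in> I\<close> in \<open>auto simp: PiE_iff extensional_def split: if_splits\<close>)
  also have "\<dots> = card K * (\<Sum>\<omega>\<in>?\<Omega>. G \<omega>)"
    by (simp add: sum.cartesian_product[symmetric] sum_distrib_left)
  finally show ?thesis .
qed

section \<open>Coordinate projections onto blocks\<close>

lemma blk_inner_Basis:
  assumes "S \<subseteq> Basis" "b \<in> Basis"
  shows "blk S x \<bullet> b = (if b \<in> S then x \<bullet> b else 0)"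
proof -
  have "blk S x \<bullet> b = (\<Sum>c\<in>S. if c = b then x \<bullet> b else 0)"
    unfolding blk_def inner_sum_left
    by (intro sum.cong refl) (use assms in \<open>auto simp: inner_Basis\<close>)
  also have "\<dots> = (if b \<in> S then x \<bullet> b else 0)"
    using finite_subset[OF assms(1) finite_Basis] by (simp add: sum.delta')
  finally show ?thesis .
qed

lemma linear_blk: "linear (blk S)"
  unfolding blk_def
  by (intro linear_compose_sum ballI linearI) (auto simp: inner_add_left scaleR_add_left)

lemma blk_in_span: "blk S x \<in> span S"
  unfolding blk_def by (rule span_sum, rule span_scale, rule span_base)

lemma blk_of_span:
  assumes "S \<subseteq> Basis" "v \<in> span S"
  shows "blk S v = v"
  using assms(2)
proof (induction rule: span_induct_alt)
  case base
  show ?case by (simp add: linear_0[OF linear_blk])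
next
  case (step c x y)
  have "blk S x = x"
    using assms(1) step(1) by (subst euclidean_eq_iff) (auto simp: blk_inner_Basis inner_Basis)
  then show ?case using step by (simp add: linear_add[OF linear_blk] linear_cmul[OF linear_blk])
qed

lemma blk_inner_commute: "blk S x \<bullet> y = x \<bullet> blk S y"
  unfolding blk_def inner_sum_left inner_sum_right
  by (intro sum.cong refl) (simp add: inner_commute[of _ y])

section \<open>Step sizes and contraction factors\<close>

text \<open>In terms of z = (m - 1) * (1 - \<alpha>) the step sizes become rational, and the square
  root in \<alpha> is what makes the last identity hold. That identity states that the proximal
  weight \<eta> exactly matches the extrapolation error in \<open>inner_step\<close>. The value z =
  1, hence \<eta> = 0, occurs for \<open>Ab = 0\<close>.\<close>

lemma rap_parameters:
  fixes mu L Ab :: real and m :: nat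
  assumes "3 \<le> m" "0 < mu" "mu \<le> L"
  defines "\<alpha> \<equiv> rap_alpha m mu L Ab" and "N \<equiv> real m - 1"
  obtains z where "0 < z" "z \<le> 1" "1 - \<alpha> = z / N"
    "rap_eta m mu \<alpha> = mu * (1 - z) / z"
    "2 * (L + 2 * mu) * (z / N) * N * Ab\<^sup>2 = mu * (1 - z) / z"
proof -
  define c where "c = (L + 2 * mu) * Ab\<^sup>2 / mu"
  define S where "S = sqrt (1 + 8 * c)"
  define z where "z = 2 / (S + 1)"
  have "0 \<le> c" using assms(2,3) by (simp add: c_def)
  then have S1: "1 \<le> S" and S2: "S\<^sup>2 = 1 + 8 * c" by (auto simp: S_def)
  have z: "0 < z" "z \<le> 1" using S1 by (auto simp: z_def field_simps)
  have N: "2 \<le> N" using assms(1) by (simp add: N_def)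
  have \<alpha>: "1 - \<alpha> = z / N" unfolding \<alpha>_def rap_alpha_def Let_def c_def[symmetric] S_def[symmetric] N_def[symmetric] z_def
    by (simp add: mult.commute)
  have \<alpha>2: "\<alpha> - (real m - 2) / (real m - 1) = (1 - z) / N"
  proof -
    have "\<alpha> = 1 - z / N" using \<alpha> by simp
    moreover have "real m - 2 = N - 1" by (simp add: N_def)
    ultimately show ?thesis unfolding N_def[symmetric] using N by (simp add: field_simps)
  qed
  have \<eta>: "rap_eta m mu \<alpha> = mu * (1 - z) / z"
    unfolding rap_eta_def \<alpha>2 \<alpha> using N z by (simp add: field_simps)
  have S: "S = 2 / z - 1" using S1 by (simp add: z_def field_simps)
  have cz: "8 * c = 4 * (1 - z) / z\<^sup>2"
    using S2 z unfolding S by (simp add: power2_eq_square field_simps)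
  have "2 * (L + 2 * mu) * (z / N) * N * Ab\<^sup>2 = 2 * mu * z * c"
    using N assms(2) by (simp add: c_def)
  also have "\<dots> = mu * z / 4 * (8 * c)" by simp
  also have "\<dots> = mu * (1 - z) / z" unfolding cz using z by (simp add: power2_eq_square field_simps)
  finally show thesis using that z \<alpha> \<eta> by blast
qed

text \<open>A reverse of 1 - b \<le> exp (- b), with 3 / 2 in the exponent; it follows from
  multiplying the quadratic Taylor bound of exp (3 / 2 * b) by 1 - b.\<close>

lemma exp_minus_le_one_minus:
  fixes b :: real
  assumes "0 \<le> b" "b \<le> 1 / 2"
  shows "exp (- (3 / 2 * b)) \<le> 1 - b"
proof -
  have "1 \<le> (1 + 3 / 2 * b + (3 / 2 * b)\<^sup>2 / 2) * (1 - b)"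
  proof -
    have "3 / 8 * b + 9 / 8 * b\<^sup>2 \<le> 1 / 2"
      using assms mult_mono[of b "1 / 2" b "1 / 2"] by (simp add: power2_eq_square)
    then have "0 \<le> b * (1 / 2 - 3 / 8 * b - 9 / 8 * b\<^sup>2)" using assms by (intro mult_nonneg_nonneg) auto
    moreover have "(1 + 3 / 2 * b + (3 / 2 * b)\<^sup>2 / 2) * (1 - b) = 1 + b * (1 / 2 - 3 / 8 * b - 9 / 8 * b\<^sup>2)"
      by (simp add: power2_eq_square field_simps)
    ultimately show ?thesis by simp
  qed
  also have "\<dots> \<le> exp (3 / 2 * b) * (1 - b)"
    using assms exp_lower_Taylor_quadratic[of "3 / 2 * b"] by (intro mult_right_mono) auto
  finally show ?thesis by (simp add: exp_minus field_simps)
qed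

text \<open>The hypothesis forces b * s \<ge> 1, because 1 / 6 < exp (- 3 / 2). Then the left side
  is at most exp (- q), which is at most 1 / (1 + q).\<close>

lemma contraction_gain:
  fixes b q :: real
  assumes b: "0 < b" "b \<le> 1 / 2" and q: "0 < q" "q \<le> 1" and s: "(1 - b) ^ s \<le> 1 / 6"
  shows "(1 - q * b) ^ s \<le> 1 / (1 + q)"
proof -
  have "exp (- (3 / 2 * b * s)) = exp (- (3 / 2 * b)) ^ s"
    by (simp add: exp_of_nat_mult[symmetric] mult_ac)
  also have "\<dots> \<le> (1 - b) ^ s"
    using b by (intro power_mono exp_minus_le_one_minus) auto
  also have "\<dots> \<le> 1 / 6" by (rule s)
  also have "1 / 6 < exp (- (3 / 2 :: real))"
  proof -
    \<comment> \<open>Squaring reduces the claim to exp 1 \<le> 3, as 27 < 36.\<close>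
    have "exp (3 / 2 :: real) ^ 2 = exp 1 ^ 3" by (simp add: exp_of_nat_mult[symmetric])
    also have "\<dots> \<le> 3 ^ 3" by (intro power_mono exp_le) auto
    also have "\<dots> < 6 ^ (2 :: nat)" by simp
    finally have "exp (3 / 2 :: real) < 6" by (rule power_less_imp_less_base) simp
    then show ?thesis by (simp add: exp_minus field_simps)
  qed
  finally have bs: "1 \<le> b * s" by simp
  have "(1 - q * b) ^ s \<le> exp (- (q * b)) ^ s"
    using q b mult_mono[of q 1 b "1 / 2"] exp_ge_add_one_self[of "- (q * b)"] by (intro power_mono) auto
  also have "\<dots> = exp (- (q * (b * s)))" by (simp add: exp_of_nat_mult[symmetric] mult_ac)
  also have "\<dots> \<le> exp (- q)" using q bs by simp
  also have "\<dots> = 1 / exp q" by (simp add: exp_minus field_simps)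
  also have "\<dots> \<le> 1 / (1 + q)" using q by (intro divide_left_mono) auto
  finally show ?thesis .
qed

text \<open>Weights of the primal distance in the Lyapunov function. At the last step a factor
  \<^term>\<open>1 + q\<close> is lost, which is compensated by contracting at the rate \<^term>\<open>\<alpha> * \<rho>\<close> instead of
  \<^term>\<open>\<alpha>\<close>. For \<^term>\<open>z\<close> close to 1 the primal distance contracts no faster than \<^term>\<open>\<alpha>\<close>, so
  that its weight has to decrease along the iteration.\<close>

lemma lyapunov_weights:
  fixes z N q \<alpha> \<beta> :: real
  assumes z: "0 < z" "z \<le> 1" and N: "2 \<le> N" and \<beta>: "\<beta> = z / N" and \<alpha>: "\<alpha> = 1 - \<beta>"
    and q: "0 < q" "q \<le> 1 / 3" and s: "\<alpha> ^ s \<le> 1 / 6"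
  obtains \<rho> and \<omega> :: "nat \<Rightarrow> real" where "1 - \<beta> * q \<le> \<rho>" "(1 + q) * \<rho> ^ s \<le> 1"
    "\<And>t. \<omega> t \<le> 1 + z" "\<And>t. t < s \<Longrightarrow> \<omega> (Suc t) * (1 - 1 / N) + (1 - z) / N \<le> \<alpha> * \<rho> * \<omega> t"
    "\<omega> 0 \<le> 1 + q" "1 \<le> \<omega> s"
proof -
  have b: "0 < \<beta>" "\<beta> \<le> 1 / 2"
  proof -
    have "z / N \<le> 1 / 2" using z N by (intro frac_le) auto
    then show "0 < \<beta>" "\<beta> \<le> 1 / 2" using z N by (auto simp: \<beta>)
  qed
  have gain: "(1 - q * \<beta>) ^ s \<le> 1 / (1 + q)"
    using contraction_gain[OF b, of q s] q s by (simp add: \<alpha>)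
  have q\<beta>: "q * \<beta> \<le> 1 / 6" using mult_mono[of q "1 / 3" \<beta> "1 / 2"] q b by simp
  show thesis
  proof (cases "q \<le> z")
    case False
    \<comment> \<open>For z < q the constant weight 1 + z suffices: it is below 1 + q, and (1 + q) *
      (1 + z) \<le> 2 since both factors are at most 4 / 3.\<close>
    let ?\<rho> = "1 - \<beta> * q" and ?\<omega> = "\<lambda>t::nat. 1 + z"
    have "(1 + z) * (1 - 1 / N) + (1 - z) / N \<le> \<alpha> * ?\<rho> * (1 + z)"
    proof -
      have "z * ((1 + q) * (1 + z)) \<le> z * 2"
        using z q False mult_mono[of "1 + q" "4 / 3" "1 + z" "4 / 3"] by (intro mult_left_mono) auto
      then have "z * ((1 + q) * (1 + z)) / N \<le> z * 2 / N"
        using N by (intro divide_right_mono) auto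
      moreover have "(1 + z) * (1 - 1 / N) + (1 - z) / N = (1 + z) - z * 2 / N"
        using N by (simp add: field_simps)
      moreover have "(1 + z) * (1 - (1 + q) * \<beta>) = (1 + z) - z * ((1 + q) * (1 + z)) / N"
        using N unfolding \<beta> by (simp add: field_simps)
      ultimately have "(1 + z) * (1 - 1 / N) + (1 - z) / N \<le> (1 + z) * (1 - (1 + q) * \<beta>)" by simp
      also have "\<dots> \<le> (1 + z) * (\<alpha> * ?\<rho>)"
        using z q b unfolding \<alpha> by (intro mult_left_mono) (auto simp: algebra_simps)
      finally show ?thesis by (simp add: mult_ac)
    qed
    then show thesis
      using z q b gain False by (intro that[of ?\<rho> ?\<omega>]) (auto simp: mult.commute field_simps)
  next
    case True
    have s0: "0 < s"
      using s by (cases s) auto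
    \<comment> \<open>For q \<le> z the rate is tuned so that s steps gain exactly the factor 1 + q;
      \<open>gain\<close> ensures that it is not below 1 - \<beta> * q.\<close>
    define \<rho> where "\<rho> = root s (1 / (1 + q))"
    have \<rho>s: "\<rho> ^ s = 1 / (1 + q)" using s0 q by (simp add: \<rho>_def)
    have \<rho>0: "0 < \<rho>" using s0 q by (simp add: \<rho>_def)
    have \<rho>1: "\<rho> \<le> 1" using s0 q by (simp add: \<rho>_def)
    have \<rho>q: "1 - \<beta> * q \<le> \<rho>"
      using gain s0 \<rho>0 unfolding \<rho>s[symmetric] by (subst (asm) power_mono_iff) (use q\<beta> in \<open>auto simp: mult.commute\<close>)
    \<comment> \<open>The weight falls from 1 + q to 1 at the rate \<rho>; capping the exponent at s
      keeps it at least 1 for all t.\<close>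
    define \<omega> where "\<omega> t = (1 + q) * \<rho> ^ min t s" for t
    have \<omega>1: "1 \<le> \<omega> t" for t
    proof -
      have "\<rho> ^ s \<le> \<rho> ^ min t s" using \<rho>0 \<rho>1 by (intro power_decreasing) auto
      then have "(1 + q) * \<rho> ^ s \<le> \<omega> t" unfolding \<omega>_def using q by (intro mult_left_mono) auto
      then show ?thesis using q by (simp add: \<rho>s)
    qed
    have \<omega>q: "\<omega> t \<le> 1 + q" for t
      unfolding \<omega>_def using q \<rho>0 \<rho>1 power_le_one[of \<rho> "min t s"] by simp
    have step: "\<omega> (Suc t) * (1 - 1 / N) + (1 - z) / N \<le> \<alpha> * \<rho> * \<omega> t" if "t < s" for t
    proof -
      have "\<rho> * \<omega> t = \<omega> (Suc t)" using that by (simp add: \<omega>_def min_def)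
      \<comment> \<open>As the weight is at least 1, the summand (1 - z) / N may be multiplied by
        it, which leaves \<alpha> times the weight.\<close>
      moreover have "(1 - z) * 1 \<le> (1 - z) * \<omega> (Suc t)" using z \<omega>1 by (intro mult_left_mono) auto
      then have "(1 - z) / N \<le> (1 - z) * \<omega> (Suc t) / N"
        using N by (intro divide_right_mono) auto
      then have "\<omega> (Suc t) * (1 - 1 / N) + (1 - z) / N \<le> \<alpha> * \<omega> (Suc t)"
        unfolding \<alpha> \<beta> by (simp add: left_diff_distrib right_diff_distrib diff_divide_distrib mult.commute)
      ultimately show ?thesis by (simp add: mult.assoc)
    qed
    show thesis
    proof (rule that[of \<rho> \<omega>])
      show "(1 + q) * \<rho> ^ s \<le> 1" using q by (simp add: \<rho>s)
      show "\<omega> t \<le> 1 + z" for t using \<omega>q[of t] True by simp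
    qed (use \<rho>q step \<omega>q \<omega>1 in auto)
  qed
qed

text \<open>The first factor of M equals (L + 2 * mu) / mu, the price of bounding the initial
  Lyapunov value by squared distances; the factor \<open>K\<close> remains as contraction. The
  second bound is M \<ge> 6.\<close>

lemma rap_s_bound:
  fixes mu L \<alpha> :: real
  assumes "0 < mu" "mu \<le> L" "0 < \<alpha>" "\<alpha> < 1"
  defines "s \<equiv> rap_s mu L \<alpha>"
  shows "\<alpha> ^ s * ((L + 2 * mu) / mu) \<le> 1 / max 2 (L\<^sup>2 / mu\<^sup>2)" and "\<alpha> ^ s \<le> 1 / 6"
proof -
  define K where "K = max 2 (L\<^sup>2 / mu\<^sup>2)"
  define M where "M = (2 + L / mu) * K"
  have L: "3 \<le> 2 + L / mu" using assms by (simp add: field_simps)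
  have K: "2 \<le> K" by (simp add: K_def)
  have M6: "6 \<le> M" using mult_mono[OF L K] L K by (simp add: M_def)
  have "- ln M / ln \<alpha> \<le> s"
    unfolding s_def rap_s_def M_def K_def by linarith
  moreover have "ln \<alpha> < 0" using assms by simp
  ultimately have "s * ln \<alpha> \<le> - ln M" using neg_divide_le_eq by blast
  then have "ln (\<alpha> ^ s) \<le> ln (1 / M)" using assms M6 by (simp add: ln_realpow ln_div)
  then have *: "\<alpha> ^ s \<le> 1 / M" using assms M6 by (subst (asm) ln_le_cancel_iff) auto
  also have "1 / M \<le> 1 / 6" using M6 by (intro divide_left_mono) auto
  finally show "\<alpha> ^ s \<le> 1 / 6" .
  have "(L + 2 * mu) / mu = 2 + L / mu" using assms by (simp add: field_simps)
  then have "\<alpha> ^ s * ((L + 2 * mu) / mu) \<le> 1 / M * (2 + L / mu)"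
    using * L M6 by (intro mult_mono) auto
  also have "\<dots> = 1 / K" using L by (simp add: M_def)
  finally show "\<alpha> ^ s * ((L + 2 * mu) / mu) \<le> 1 / max 2 (L\<^sup>2 / mu\<^sup>2)" by (simp add: K_def)
qed

section \<open>The proximal subproblems\<close>

text \<open>Adaptedness: the state after t steps ignores later indices. This and the analogous fact
  for rounds allow one index to be redrawn without touching the past.\<close>

lemma radual_cong:
  "(\<And>j. j \<le> t \<Longrightarrow> idx j = idx' j) \<Longrightarrow>
    radual m B Xs A bv f gfm mu \<alpha>t \<tau> \<eta> xb xbm idx t = radual m B Xs A bv f gfm mu \<alpha>t \<tau> \<eta> xb xbm idx' t"
proof (induction t)
  case (Suc t)
  then have "radual m B Xs A bv f gfm mu \<alpha>t \<tau> \<eta> xb xbm idx t = radual m B Xs A bv f gfm mu \<alpha>t \<tau> \<eta> xb xbm idx' t"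
    and "idx (Suc t) = idx' (Suc t)" by auto
  then show ?case by simp
qed simp

lemma rapdual_cong:
  "(\<And>p. fst p \<le> l \<Longrightarrow> \<omega> p = \<omega>' p) \<Longrightarrow>
    rapdual m B Xs A bv f fm gfm mu \<alpha>t \<tau> \<eta> s x0 xm0 \<omega> l = rapdual m B Xs A bv f fm gfm mu \<alpha>t \<tau> \<eta> s x0 xm0 \<omega>' l"
proof (induction l)
  case (Suc l)
  then have "rapdual m B Xs A bv f fm gfm mu \<alpha>t \<tau> \<eta> s x0 xm0 \<omega> l = rapdual m B Xs A bv f fm gfm mu \<alpha>t \<tau> \<eta> s x0 xm0 \<omega>' l"
    and "(\<lambda>t. \<omega> (Suc l, t)) = (\<lambda>t. \<omega>' (Suc l, t))" by auto
  then show ?case by simp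
qed simp

locale rap_setting =
  fixes m :: nat
    and B :: "nat \<Rightarrow> 'a::euclidean_space set"
    and Xs :: "nat \<Rightarrow> 'a set"
    and A :: "'a \<Rightarrow> 'b::euclidean_space"
    and bv :: 'b
    and f :: "nat \<Rightarrow> 'a \<Rightarrow> real" and gf :: "nat \<Rightarrow> 'a \<Rightarrow> 'a"
    and fm :: "'b \<Rightarrow> real" and gfm :: "'b \<Rightarrow> 'b"
    and mu L :: real
  assumes m3: "m \<ge> 3"
    and B_sub: "\<forall>i\<in>{1..m-1}. B i \<subseteq> Basis"
    and B_disj: "\<forall>i\<in>{1..m-1}. \<forall>j\<in>{1..m-1}. i \<noteq> j \<longrightarrow> B i \<inter> B j = {}"
    and B_cover: "(\<Union>i\<in>{1..m-1}. B i) = Basis"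
    and X_sub: "\<forall>i\<in>{1..m-1}. Xs i \<subseteq> span (B i)"
    and X_ne: "\<forall>i\<in>{1..m-1}. Xs i \<noteq> {}"
    and X_closed: "\<forall>i\<in>{1..m-1}. closed (Xs i)"
    and X_convex: "\<forall>i\<in>{1..m-1}. convex (Xs i)"
    and A_lin: "linear A"
    and mu_pos: "0 < mu" and mu_le_L: "mu \<le> L"
    and f_grad: "\<forall>i\<in>{1..m-1}. \<forall>x\<in>Xs i. gf i x \<in> span (B i) \<and>
                   (f i has_derivative (\<lambda>h. gf i x \<bullet> h)) (at x within span (B i))"
    and f_weak: "\<forall>i\<in>{1..m-1}. \<forall>x\<in>Xs i. \<forall>y\<in>Xs i.
                   f i x - f i y - gf i y \<bullet> (x - y) \<ge> - (mu / 2) * (norm (x - y))\<^sup>2"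
    and fm_grad: "\<forall>x. (fm has_derivative (\<lambda>h. gfm x \<bullet> h)) (at x)"
    and fm_weak: "\<forall>x y. fm x - fm y - gfm y \<bullet> (x - y) \<ge> - (mu / 2) * (norm (x - y))\<^sup>2"
    and fm_lip: "\<forall>x y. norm (gfm x - gfm y) \<le> L * norm (x - y)"
begin

declare One_nat_def [simp del]

abbreviation I :: "nat set" where "I \<equiv> {1..m-1}"
abbreviation X :: "'a set" where "X \<equiv> prodX m B Xs"

lemma card_I: "real (card I) = real m - 1"
  using m3 by simp

section \<open>Block decomposition of the space, of \<open>X\<close> and of the objective\<close>

lemma B_sub': "i \<in> I \<Longrightarrow> B i \<subseteq> Basis"
  using B_sub by blast

lemma sum_blk: "(\<Sum>i\<in>I. blk (B i) x) = x"
proof -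
  have "(\<Sum>i\<in>I. blk (B i) x) = (\<Sum>b\<in>(\<Union>i\<in>I. B i). (x \<bullet> b) *\<^sub>R b)"
    unfolding blk_def
    by (rule sum.UNION_disjoint[symmetric])
      (use B_disj in \<open>auto intro: finite_subset[OF B_sub']\<close>)
  then show ?thesis unfolding B_cover by (simp add: euclidean_representation)
qed

lemma blk_blk:
  assumes "i \<in> I" "j \<in> I"
  shows "blk (B i) (blk (B j) x) = (if i = j then blk (B i) x else 0)"
proof (rule euclidean_eqI)
  fix b :: 'a assume "b \<in> Basis"
  moreover have "b \<notin> B i" if "b \<in> B j" "i \<noteq> j" using B_disj assms that by blast
  ultimately show "blk (B i) (blk (B j) x) \<bullet> b = (if i = j then blk (B i) x else 0) \<bullet> b"
    using assms by (auto simp: blk_inner_Basis[OF B_sub'])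
qed

lemma blk_sum:
  assumes "j \<in> I" "\<And>i. i \<in> I \<Longrightarrow> v i \<in> span (B i)"
  shows "blk (B j) (\<Sum>i\<in>I. v i) = v j"
proof -
  have "blk (B j) (\<Sum>i\<in>I. v i) = (\<Sum>i\<in>I. blk (B j) (blk (B i) (v i)))"
    unfolding linear_sum[OF linear_blk]
    by (intro sum.cong refl arg_cong[of _ _ "blk (B j)"]) (simp add: blk_of_span[OF B_sub'] assms)
  also have "\<dots> = (\<Sum>i\<in>I. if i = j then v j else 0)"
  proof (intro sum.cong refl)
    fix i assume "i \<in> I"
    then show "blk (B j) (blk (B i) (v i)) = (if i = j then v j else 0)"
      using assms blk_blk[of j i "v i"] by (cases "i = j") (auto simp: blk_of_span[OF B_sub'])
  qed
  also have "\<dots> = v j" using \<open>j \<in> I\<close> by (subst sum.delta) auto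
  finally show ?thesis .
qed

lemma inner_blocks: "x \<bullet> y = (\<Sum>i\<in>I. blk (B i) x \<bullet> blk (B i) y)"
proof -
  have "x \<bullet> y = (\<Sum>i\<in>I. blk (B i) x \<bullet> y)"
    by (subst sum_blk[of x, symmetric]) (rule inner_sum_left)
  also have "\<dots> = (\<Sum>i\<in>I. blk (B i) x \<bullet> blk (B i) y)"
    by (intro sum.cong refl) (simp add: blk_inner_commute[symmetric] blk_blk)
  finally show ?thesis .
qed

lemma norm2_blocks: "(norm x)\<^sup>2 = (\<Sum>i\<in>I. (norm (blk (B i) x))\<^sup>2)"
  unfolding power2_norm_eq_inner by (rule inner_blocks)

lemma X_blk: "x \<in> X \<Longrightarrow> i \<in> I \<Longrightarrow> blk (B i) x \<in> Xs i"
  by (simp add: prodX_def)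

lemma sum_in_X:
  assumes "\<And>i. i \<in> I \<Longrightarrow> v i \<in> Xs i"
  shows "(\<Sum>i\<in>I. v i) \<in> X"
proof -
  have "blk (B j) (\<Sum>i\<in>I. v i) = v j" if "j \<in> I" for j
    using X_sub assms by (intro blk_sum[OF that]) blast
  then show ?thesis unfolding prodX_def using assms by auto
qed

lemma convex_X: "convex X"
proof (rule convexI)
  fix x y u v assume *: "x \<in> X" "y \<in> X" "0 \<le> u" "0 \<le> v" "u + v = (1::real)"
  show "u *\<^sub>R x + v *\<^sub>R y \<in> X"
    unfolding prodX_def
  proof (intro CollectI ballI)
    fix i assume "i \<in> I"
    then show "blk (B i) (u *\<^sub>R x + v *\<^sub>R y) \<in> Xs i"
      unfolding linear_add[OF linear_blk] linear_cmul[OF linear_blk]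
      using * X_convex by (intro convexD X_blk) auto
  qed
qed

lemma continuous_on_blk: "continuous_on S (blk T)"
  by (rule linear_continuous_on) (simp add: linear_blk linear_conv_bounded_linear[symmetric])

lemma closed_X: "closed X"
proof -
  have "X = (\<Inter>i\<in>I. blk (B i) -` Xs i)" by (auto simp: prodX_def)
  also have "closed \<dots>"
    using X_closed by (intro closed_INT ballI closed_vimage continuous_on_blk) auto
  finally show ?thesis .
qed

abbreviation F :: "'a \<Rightarrow> real" where "F \<equiv> fsum m B f"
abbreviation G :: "'a \<Rightarrow> 'a" where "G \<equiv> gsum m B gf"

text \<open>Each block gradient lies in its own subspace, so it is fixed by the block projection,
  which is self-adjoint and can be moved onto \<open>h\<close>.\<close>

lemma G_inner:
  assumes "x \<in> X"
  shows "G x \<bullet> h = (\<Sum>i\<in>I. gf i (blk (B i) x) \<bullet> blk (B i) h)"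
proof -
  have "G x \<bullet> h = (\<Sum>i\<in>I. gf i (blk (B i) x) \<bullet> h)"
    unfolding gsum_def by (rule inner_sum_left)
  also have "\<dots> = (\<Sum>i\<in>I. blk (B i) (gf i (blk (B i) x)) \<bullet> h)"
    by (intro sum.cong refl) (use f_grad X_blk[OF assms] in \<open>simp add: blk_of_span[OF B_sub']\<close>)
  finally show ?thesis by (simp add: blk_inner_commute)
qed

lemma F_lower:
  assumes "x \<in> X" "y \<in> X"
  shows "F y + G y \<bullet> (x - y) - mu / 2 * (norm (x - y))\<^sup>2 \<le> F x"
proof -
  have "F y + G y \<bullet> (x - y) - mu / 2 * (norm (x - y))\<^sup>2
      = (\<Sum>i\<in>I. f i (blk (B i) y) + gf i (blk (B i) y) \<bullet> (blk (B i) x - blk (B i) y)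
          - mu / 2 * (norm (blk (B i) x - blk (B i) y))\<^sup>2)"
    unfolding fsum_def G_inner[OF assms(2)] norm2_blocks[of "x - y"] linear_diff[OF linear_blk]
    by (simp add: sum.distrib sum_subtractf sum_distrib_left)
  also have "\<dots> \<le> F x"
    unfolding fsum_def
  proof (rule sum_mono)
    fix i assume "i \<in> I"
    then show "f i (blk (B i) y) + gf i (blk (B i) y) \<bullet> (blk (B i) x - blk (B i) y)
          - mu / 2 * (norm (blk (B i) x - blk (B i) y))\<^sup>2 \<le> f i (blk (B i) x)"
      using f_weak[rule_format, OF _ X_blk[OF assms(1)] X_blk[OF assms(2)], of i] by simp
  qed
  finally show ?thesis .
qed

text \<open>\<open>f i\<close> is differentiable only relative to \<open>span (B i)\<close>, but the
  projection maps into that subspace, so the composition is differentiable in the whole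
  space.\<close>

lemma F_has_derivative:
  assumes "x \<in> X"
  shows "(F has_derivative (\<lambda>h. G x \<bullet> h)) (at x)"
proof -
  have "((\<lambda>x. f i (blk (B i) x)) has_derivative (\<lambda>h. gf i (blk (B i) x) \<bullet> blk (B i) h)) (at x)"
    if i: "i \<in> I" for i
  proof (rule has_derivative_in_compose[where g = "f i" and f = "blk (B i)"])
    show "(blk (B i) has_derivative blk (B i)) (at x)"
      by (intro bounded_linear_imp_has_derivative) (simp add: linear_blk linear_conv_bounded_linear[symmetric])
    show "(f i has_derivative (\<lambda>h. gf i (blk (B i) x) \<bullet> h)) (at (blk (B i) x) within range (blk (B i)))"
      using f_grad X_blk[OF assms i] i
      by (intro has_derivative_subset[where s = "span (B i)" and t = "range _", rotated]) (auto simp: blk_in_span)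
  qed
  then show ?thesis unfolding fsum_def G_inner[OF assms] by (rule has_derivative_sum)
qed

lemma f_continuous: "i \<in> I \<Longrightarrow> continuous_on (Xs i) (f i)"
  unfolding continuous_on_eq_continuous_within
proof
  fix x assume "i \<in> I" "x \<in> Xs i"
  then have "continuous (at x within span (B i)) (f i)"
    using f_grad has_derivative_continuous by blast
  then show "continuous (at x within Xs i) (f i)"
    by (rule continuous_within_subset) (use X_sub \<open>i \<in> I\<close> in blast)
qed

section \<open>The regularised functions and the Bregman distance of \<open>\<psi>m\<close>\<close>

definition \<psi>m :: "'b \<Rightarrow> 'b \<Rightarrow> real" where
  "\<psi>m c u = fm u + mu * (norm (u - c))\<^sup>2"

definition g\<psi>m :: "'b \<Rightarrow> 'b \<Rightarrow> 'b" where
  "g\<psi>m c u = gfm u + (2 * mu) *\<^sub>R (u - c)"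

definition bregman :: "'b \<Rightarrow> 'b \<Rightarrow> 'b \<Rightarrow> real" where
  "bregman c u v = \<psi>m c u - \<psi>m c v - g\<psi>m c v \<bullet> (u - v)"

lemma norm2_prox_expand:
  fixes u v c :: "'c::real_inner"
  shows "(norm (u - c))\<^sup>2 = (norm (v - c))\<^sup>2 + 2 * ((v - c) \<bullet> (u - v)) + (norm (u - v))\<^sup>2"
proof -
  have "u - c = (v - c) + (u - v)" by simp
  then have "(norm (u - c))\<^sup>2 = ((v - c) + (u - v)) \<bullet> ((v - c) + (u - v))"
    by (simp only: power2_norm_eq_inner)
  then show ?thesis unfolding inner_add_left inner_add_right power2_norm_eq_inner inner_commute[of "u - v" "v - c"] by simp
qed

text \<open>The prox-centre drops out and the quadratic term contributes mu times the squared
  distance. This turns the curvature bounds -mu and L of \<open>fm\<close> into mu and L + 2 * mu in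
  the next two lemmas.\<close>

lemma bregman_alt:
  "bregman c u v = fm u - fm v - gfm v \<bullet> (u - v) + mu * (norm (u - v))\<^sup>2"
  unfolding bregman_def \<psi>m_def g\<psi>m_def norm2_prox_expand[of u c v]
  by (simp add: inner_add_left algebra_simps)

lemma bregman_lower: "mu / 2 * (norm (u - v))\<^sup>2 \<le> bregman c u v"
  using fm_weak[rule_format, of v u] fm_weak[rule_format, of u v] unfolding bregman_alt by simp

lemma bregman_upper: "bregman c u v \<le> (L + 2 * mu) / 2 * (norm (u - v))\<^sup>2"
  using lipschitz_gradient_upper_bound[of fm gfm L u v] fm_grad fm_lip
  unfolding bregman_alt by (simp add: algebra_simps add_divide_distrib)

lemma bregman_three_point:
  "bregman c u w = bregman c u v + bregman c v w + (g\<psi>m c v - g\<psi>m c w) \<bullet> (u - v)"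
  unfolding bregman_def inner_diff_left inner_diff_right by simp

lemma bregman_sym:
  "bregman c u v + bregman c v u = (g\<psi>m c u - g\<psi>m c v) \<bullet> (u - v)"
  unfolding bregman_def inner_diff_left inner_diff_right by simp

lemma A_bounded_linear: "bounded_linear A"
  using A_lin linear_conv_bounded_linear by blast

lemma norm_A_block:
  assumes "i \<in> I" "w \<in> span (B i)"
  shows "norm (A w) \<le> Abar m B A * norm w"
proof -
  have bl: "bounded_linear (\<lambda>x. A (blk (B i) x))"
    using linear_compose[OF linear_blk A_lin, of "B i"] by (simp add: linear_conv_bounded_linear o_def)
  have "norm (A w) = norm (A (blk (B i) w))"
    using blk_of_span[OF B_sub' assms(2)] assms(1) by simp
  also have "\<dots> \<le> onorm (\<lambda>x. A (blk (B i) x)) * norm w"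
    by (rule onorm[OF bl])
  also have "\<dots> \<le> Abar m B A * norm w"
    unfolding Abar_def using assms(1) by (intro mult_right_mono Max_ge) auto
  finally show ?thesis .
qed

lemma X_nonempty: "X \<noteq> {}"
proof -
  have "\<forall>i\<in>I. \<exists>v. v \<in> Xs i" using X_ne by blast
  then obtain v where "\<forall>i\<in>I. v i \<in> Xs i" by (auto dest: bchoice)
  then show ?thesis using sum_in_X[of v] by blast
qed

definition \<psi> :: "'a \<Rightarrow> 'a \<Rightarrow> real" where
  "\<psi> c x = F x + mu * (norm (x - c))\<^sup>2"

definition g\<psi> :: "'a \<Rightarrow> 'a \<Rightarrow> 'a" where
  "g\<psi> c x = G x + (2 * mu) *\<^sub>R (x - c)"

lemma \<psi>_lower:
  assumes "x \<in> X" "y \<in> X"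
  shows "\<psi> c y + g\<psi> c y \<bullet> (x - y) + mu / 2 * (norm (x - y))\<^sup>2 \<le> \<psi> c x"
  using F_lower[OF assms] unfolding \<psi>_def g\<psi>_def norm2_prox_expand[of x c y] inner_add_left inner_scaleR_left
  by (simp add: distrib_left)

lemma norm2_has_derivative:
  "((\<lambda>x. c * (norm (x - a))\<^sup>2) has_derivative (\<lambda>h. ((2 * c) *\<^sub>R (x - a)) \<bullet> h)) (at x)"
  for x a :: "'c::real_inner"
  unfolding power2_norm_eq_inner
  by (rule derivative_eq_intros refl)+ (auto simp: inner_commute algebra_simps)

lemma \<psi>_has_derivative: "x \<in> X \<Longrightarrow> (\<psi> c has_derivative (\<lambda>h. g\<psi> c x \<bullet> h)) (at x)"
  unfolding \<psi>_def g\<psi>_def inner_add_left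
  by (intro has_derivative_add F_has_derivative norm2_has_derivative)

lemma \<psi>m_has_derivative: "(\<psi>m c has_derivative (\<lambda>h. g\<psi>m c u \<bullet> h)) (at u)"
  unfolding \<psi>m_def g\<psi>m_def inner_add_left
  using fm_grad by (intro has_derivative_add norm2_has_derivative) auto

lemma \<psi>m_lower: "\<psi>m c v + g\<psi>m c v \<bullet> (u - v) + mu / 2 * (norm (u - v))\<^sup>2 \<le> \<psi>m c u"
  using bregman_lower[of u v c] by (simp add: bregman_def)

section \<open>The subproblem with \<open>u = bv - A x\<close> eliminated: existence and first-order
  condition\<close>

definition sub_obj :: "'a \<Rightarrow> 'b \<Rightarrow> 'a \<Rightarrow> real" where
  "sub_obj xb xbm x = \<psi> xb x + \<psi>m xbm (bv - A x)"

lemma A_diff: "A (x - y) = A x - A y"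
  by (rule linear_diff[OF A_lin])

text \<open>The modulus mu comes from \<open>\<psi>\<close> alone; the quadratic gain of
  \<open>\<psi>m\<close> is discarded.\<close>

lemma sub_obj_lower:
  assumes "x \<in> X" "y \<in> X"
  shows "sub_obj xb xbm y + (g\<psi> xb y - adjoint A (g\<psi>m xbm (bv - A y))) \<bullet> (x - y)
          + mu / 2 * (norm (x - y))\<^sup>2 \<le> sub_obj xb xbm x"
proof -
  have "adjoint A (g\<psi>m xbm (bv - A y)) \<bullet> (x - y) = - (g\<psi>m xbm (bv - A y) \<bullet> (bv - A x - (bv - A y)))"
    by (simp add: adjoint_clauses[OF A_lin] A_diff inner_diff_right)
  moreover have "0 \<le> mu / 2 * (norm (bv - A x - (bv - A y)))\<^sup>2" using mu_pos by simp
  ultimately show ?thesis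
    using \<psi>_lower[OF assms, of xb] \<psi>m_lower[of xbm "bv - A y" "bv - A x"]
    unfolding sub_obj_def inner_diff_left by linarith
qed

lemma sub_obj_has_derivative:
  assumes "x \<in> X"
  shows "(sub_obj xb xbm has_derivative (\<lambda>h. g\<psi> xb x \<bullet> h - g\<psi>m xbm (bv - A x) \<bullet> A h)) (at x)"
proof -
  have "((\<lambda>x. bv - A x) has_derivative (\<lambda>h. - A h)) (at x)"
    using bounded_linear_imp_has_derivative[OF A_bounded_linear, of "at x"]
    by (auto intro!: derivative_eq_intros)
  from has_derivative_add[OF \<psi>_has_derivative[OF assms] has_derivative_compose[OF this \<psi>m_has_derivative]]
  show ?thesis unfolding sub_obj_def by simp
qed

definition is_sub_opt :: "'a \<Rightarrow> 'b \<Rightarrow> 'a \<Rightarrow> 'b \<Rightarrow> bool" where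
  "is_sub_opt xb xbm x u \<longleftrightarrow> x \<in> X \<and> A x + u = bv \<and>
     (\<forall>x'\<in>X. \<forall>u'. A x' + u' = bv \<longrightarrow> \<psi> xb x + \<psi>m xbm u \<le> \<psi> xb x' + \<psi>m xbm u')"

lemma is_sub_opt_exists: "\<exists>x u. is_sub_opt xb xbm x u"
proof -
  obtain y where "y \<in> X" using X_nonempty by blast
  have "continuous_on X (sub_obj xb xbm)"
    by (intro continuous_at_imp_continuous_on ballI has_derivative_continuous[OF sub_obj_has_derivative])
  then obtain v where v: "v \<in> X" "\<forall>w\<in>X. sub_obj xb xbm v \<le> sub_obj xb xbm w"
    using strongly_convex_attains_min[OF closed_X \<open>y \<in> X\<close> _ mu_pos sub_obj_lower[OF _ \<open>y \<in> X\<close>]] by blast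
  have "u' = bv - A x'" if "A x' + u' = bv" for x' u' using that by (auto simp: algebra_simps)
  then have "is_sub_opt xb xbm v (bv - A v)"
    using v unfolding is_sub_opt_def sub_obj_def by auto
  then show ?thesis by blast
qed

lemma sub_opt_spec:
  "is_sub_opt xb xbm (fst (sub_opt m B Xs A bv f fm mu xb xbm)) (snd (sub_opt m B Xs A bv f fm mu xb xbm))"
proof -
  have "sub_opt m B Xs A bv f fm mu xb xbm = (SOME p. case p of (x, u) \<Rightarrow> is_sub_opt xb xbm x u)"
    unfolding sub_opt_def is_sub_opt_def \<psi>_def \<psi>m_def Let_def by (simp add: add.assoc)
  moreover have "case (SOME p. case p of (x, u) \<Rightarrow> is_sub_opt xb xbm x u) of (x, u) \<Rightarrow> is_sub_opt xb xbm x u"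
    using is_sub_opt_exists[of xb xbm] by (intro someI_ex[of "\<lambda>p. case p of (x, u) \<Rightarrow> is_sub_opt xb xbm x u"]) auto
  ultimately show ?thesis by (simp add: case_prod_beta)
qed

text \<open>First-order condition of the eliminated problem over \<open>X\<close>;
  \<open>- g\<psi>m xbm us\<close> takes the place of the multiplier of the linear
  constraint.\<close>

lemma sub_opt_variational:
  assumes opt: "is_sub_opt xb xbm xs us" and x: "x \<in> X"
  shows "0 \<le> g\<psi> xb xs \<bullet> (x - xs) - g\<psi>m xbm us \<bullet> A (x - xs)"
proof -
  have xs: "xs \<in> X" and us: "us = bv - A xs"
    using opt by (auto simp: is_sub_opt_def algebra_simps)
  have "sub_obj xb xbm xs \<le> sub_obj xb xbm w" if "w \<in> X" for w
    using opt that us unfolding is_sub_opt_def sub_obj_def by auto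
  from convex_min_derivative_nonneg[OF convex_X xs this sub_obj_has_derivative[OF xs] x]
  show ?thesis by (simp add: us)
qed

section \<open>Block proximal steps\<close>

definition prox_obj :: "real \<Rightarrow> 'a \<Rightarrow> 'b \<Rightarrow> 'a \<Rightarrow> nat \<Rightarrow> 'a \<Rightarrow> real" where
  "prox_obj \<eta> xb y x1 i v = f i v + mu * (norm (v - blk (B i) xb))\<^sup>2 + y \<bullet> A v
     + \<eta> / 2 * (norm (v - blk (B i) x1))\<^sup>2"

definition prox :: "real \<Rightarrow> 'a \<Rightarrow> 'b \<Rightarrow> 'a \<Rightarrow> nat \<Rightarrow> 'a" where
  "prox \<eta> xb y x1 i = (SOME v. v \<in> Xs i \<and> (\<forall>w\<in>Xs i. prox_obj \<eta> xb y x1 i v \<le> prox_obj \<eta> xb y x1 i w))"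

text \<open>The prox-centre term contributes the modulus 2 * mu, weak convexity of
  \<open>f i\<close> costs mu, and the step-size term adds \<eta>.\<close>

lemma prox_obj_lower:
  assumes "i \<in> I" "v \<in> Xs i" "w \<in> Xs i"
  shows "prox_obj \<eta> xb y x1 i w
      + (gf i w + (2 * mu) *\<^sub>R (w - blk (B i) xb) + adjoint A y + \<eta> *\<^sub>R (w - blk (B i) x1)) \<bullet> (v - w)
      + (mu + \<eta>) / 2 * (norm (v - w))\<^sup>2 \<le> prox_obj \<eta> xb y x1 i v"
proof -
  have "f i w + gf i w \<bullet> (v - w) - mu / 2 * (norm (v - w))\<^sup>2 \<le> f i v"
    using f_weak[rule_format, OF assms] by simp
  then show ?thesis
    unfolding prox_obj_def norm2_prox_expand[of v "blk (B i) xb" w] norm2_prox_expand[of v "blk (B i) x1" w]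
      inner_add_left inner_scaleR_left adjoint_clauses[OF A_lin] A_diff inner_diff_right[of y]
    by (simp add: distrib_left distrib_right add_divide_distrib)
qed

lemma prox_spec:
  assumes i: "i \<in> I" and "0 \<le> \<eta>"
  shows "prox \<eta> xb y x1 i \<in> Xs i"
    and "w \<in> Xs i \<Longrightarrow> prox_obj \<eta> xb y x1 i (prox \<eta> xb y x1 i)
        + (mu + \<eta>) / 2 * (norm (w - prox \<eta> xb y x1 i))\<^sup>2 \<le> prox_obj \<eta> xb y x1 i w"
proof -
  obtain v0 where v0: "v0 \<in> Xs i" using X_ne i by blast
  have "continuous_on (Xs i) (prox_obj \<eta> xb y x1 i)"
    unfolding prox_obj_def
    by (intro continuous_intros f_continuous[OF i] linear_continuous_on[OF A_bounded_linear])
  then have "\<exists>v\<in>Xs i. \<forall>w\<in>Xs i. prox_obj \<eta> xb y x1 i v \<le> prox_obj \<eta> xb y x1 i w"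
    using X_closed i mu_pos \<open>0 \<le> \<eta>\<close>
    by (intro strongly_convex_attains_min[OF _ v0 _ _ prox_obj_lower[OF i _ v0]]) auto
  then have *: "prox \<eta> xb y x1 i \<in> Xs i \<and> (\<forall>w\<in>Xs i. prox_obj \<eta> xb y x1 i (prox \<eta> xb y x1 i) \<le> prox_obj \<eta> xb y x1 i w)"
    unfolding prox_def by (intro someI_ex[of "\<lambda>v. v \<in> Xs i \<and> (\<forall>w\<in>Xs i. prox_obj \<eta> xb y x1 i v \<le> prox_obj \<eta> xb y x1 i w)"]) blast
  then show "prox \<eta> xb y x1 i \<in> Xs i" by blast
  show "prox_obj \<eta> xb y x1 i (prox \<eta> xb y x1 i)
        + (mu + \<eta>) / 2 * (norm (w - prox \<eta> xb y x1 i))\<^sup>2 \<le> prox_obj \<eta> xb y x1 i w" if "w \<in> Xs i"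
    using strongly_convex_min_growth[OF X_convex[rule_format, OF i] prox_obj_lower[OF i]] * that by blast
qed

text \<open>\<open>xh\<close> is the fictitious point with every block updated. The block objectives
  add up to the full one, so the blockwise growth inequalities can be summed. Averages over the
  random block are later expressed through \<open>xh\<close>.\<close>

lemma full_prox_growth:
  fixes xb y x1 \<eta>
  assumes "0 \<le> \<eta>" "x \<in> X"
  defines "xh \<equiv> \<Sum>i\<in>I. prox \<eta> xb y x1 i"
  shows "\<psi> xb xh + y \<bullet> A xh + \<eta> / 2 * (norm (xh - x1))\<^sup>2 + (mu + \<eta>) / 2 * (norm (x - xh))\<^sup>2
      \<le> \<psi> xb x + y \<bullet> A x + \<eta> / 2 * (norm (x - x1))\<^sup>2"
proof -
  have sum_obj: "(\<Sum>i\<in>I. prox_obj \<eta> xb y x1 i (blk (B i) v)) = \<psi> xb v + y \<bullet> A v + \<eta> / 2 * (norm (v - x1))\<^sup>2" for v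
  proof -
    have "A v = (\<Sum>i\<in>I. A (blk (B i) v))"
      by (simp add: linear_sum[OF A_lin, symmetric] sum_blk)
    then show ?thesis
      unfolding \<psi>_def fsum_def prox_obj_def norm2_blocks[of "v - _"] linear_diff[OF linear_blk]
      by (simp add: sum.distrib sum_distrib_left inner_sum_right)
  qed
  have xh: "blk (B i) xh = prox \<eta> xb y x1 i" if "i \<in> I" for i
    unfolding xh_def using prox_spec(1)[OF _ \<open>0 \<le> \<eta>\<close>] X_sub by (intro blk_sum[OF that]) blast
  have "(\<Sum>i\<in>I. prox_obj \<eta> xb y x1 i (blk (B i) xh) + (mu + \<eta>) / 2 * (norm (blk (B i) x - blk (B i) xh))\<^sup>2)
      \<le> (\<Sum>i\<in>I. prox_obj \<eta> xb y x1 i (blk (B i) x))"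
  proof (rule sum_mono)
    fix i assume "i \<in> I"
    then show "prox_obj \<eta> xb y x1 i (blk (B i) xh) + (mu + \<eta>) / 2 * (norm (blk (B i) x - blk (B i) xh))\<^sup>2
      \<le> prox_obj \<eta> xb y x1 i (blk (B i) x)"
      using prox_spec(2)[OF \<open>i \<in> I\<close> assms(1) X_blk[OF \<open>x \<in> X\<close> \<open>i \<in> I\<close>]] by (simp add: xh)
  qed
  then show ?thesis
    unfolding sum.distrib sum_obj sum_distrib_left[symmetric] norm2_blocks[of "x - xh"] linear_diff[OF linear_blk] .
qed

text \<open>Growth of the proximal step, tested at \<open>xs\<close>, is added to strong convexity
  of \<open>\<psi>\<close> at \<open>xs\<close> combined with the variational inequality. The moduli
  mu + \<eta> and mu merge into \<eta> + 2 * mu.\<close>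

lemma primal_step:
  fixes x1 u \<eta>
  assumes opt: "is_sub_opt xb xbm xs us" and "0 \<le> \<eta>"
  defines "xh \<equiv> \<Sum>i\<in>I. prox \<eta> xb (- g\<psi>m xbm u) x1 i"
  shows "(g\<psi>m xbm us - g\<psi>m xbm u) \<bullet> A (xh - xs) + (\<eta> + 2 * mu) / 2 * (norm (xh - xs))\<^sup>2
      + \<eta> / 2 * (norm (xh - x1))\<^sup>2 \<le> \<eta> / 2 * (norm (x1 - xs))\<^sup>2"
proof -
  have xs: "xs \<in> X" using opt by (simp add: is_sub_opt_def)
  have xh: "xh \<in> X" unfolding xh_def using prox_spec(1)[OF _ \<open>0 \<le> \<eta>\<close>] by (intro sum_in_X)
  have 1: "\<psi> xb xh + - g\<psi>m xbm u \<bullet> A xh + \<eta> / 2 * (norm (xh - x1))\<^sup>2 + (mu + \<eta>) / 2 * (norm (xs - xh))\<^sup>2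
      \<le> \<psi> xb xs + - g\<psi>m xbm u \<bullet> A xs + \<eta> / 2 * (norm (xs - x1))\<^sup>2"
    unfolding xh_def by (rule full_prox_growth[OF \<open>0 \<le> \<eta>\<close> xs])
  have 2: "\<psi> xb xs + g\<psi>m xbm us \<bullet> A (xh - xs) + mu / 2 * (norm (xh - xs))\<^sup>2 \<le> \<psi> xb xh"
    using \<psi>_lower[OF xh xs, of xb] sub_opt_variational[OF opt xh] by linarith
  have "(mu + \<eta>) / 2 * (norm (xs - xh))\<^sup>2 + mu / 2 * (norm (xh - xs))\<^sup>2 = (\<eta> + 2 * mu) / 2 * (norm (xh - xs))\<^sup>2"
    by (simp add: norm_minus_commute[of xs xh] field_simps)
  with 1 2 show ?thesis
    unfolding A_diff inner_diff_left inner_diff_right inner_minus_left norm_minus_commute[of xs x1] by linarith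
qed

section \<open>The inner iteration\<close>

text \<open>\<alpha> times the three-point identity for \<open>uh\<close> is combined with \<beta>
  times the symmetrised Bregman identity for \<open>u\<close>. Since \<open>u\<close> is a convex
  combination and \<open>us\<close> is feasible, \<open>bv\<close> cancels and the inner products
  reduce to a multiple of \<open>A (x1 - xs)\<close>.\<close>

lemma dual_step:
  assumes "\<alpha> + \<beta> = 1" and u: "u = \<alpha> *\<^sub>R uh + \<beta> *\<^sub>R (bv - A x1)" and us: "A xs + us = bv"
  shows "bregman c u us + \<beta> * bregman c us u + \<alpha> * bregman c uh u
    = \<alpha> * bregman c uh us - \<beta> * ((g\<psi>m c u - g\<psi>m c us) \<bullet> A (x1 - xs))"
proof -
  let ?g = "g\<psi>m c u - g\<psi>m c us"
  have \<alpha>: "\<alpha> = 1 - \<beta>" using assms(1) by simp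
  have us': "us = bv - A xs" using us by (auto simp: algebra_simps)
  have "\<beta> *\<^sub>R (u - us) - \<alpha> *\<^sub>R (uh - u) = - (\<beta> *\<^sub>R A (x1 - xs))"
    unfolding us' A_diff \<alpha> u by (simp add: algebra_simps)
  then have "?g \<bullet> (\<beta> *\<^sub>R (u - us) - \<alpha> *\<^sub>R (uh - u)) = ?g \<bullet> (- (\<beta> *\<^sub>R A (x1 - xs)))" by (rule arg_cong)
  then have 1: "\<beta> * (?g \<bullet> (u - us)) - \<alpha> * (?g \<bullet> (uh - u)) = - (\<beta> * (?g \<bullet> A (x1 - xs)))"
    by (simp only: inner_diff_right[of ?g "\<beta> *\<^sub>R _"] inner_scaleR_right inner_minus_right)
  have "\<alpha> * bregman c uh us = \<alpha> * (bregman c uh u + bregman c u us + ?g \<bullet> (uh - u))"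
    using bregman_three_point[of c uh us u] by simp
  moreover have "\<beta> * (bregman c u us + bregman c us u) = \<beta> * (?g \<bullet> (u - us))"
    using bregman_sym[of c u us] by simp
  ultimately show ?thesis using 1 unfolding \<alpha> by (simp add: left_diff_distrib distrib_left)
qed

text \<open>The triangle inequality and the square (\<beta> * p - \<alpha> * r)^2 compare the
  squared norms; the curvature bounds convert them to Bregman distances. This is the source of the
  additional contraction factor 1 - \<beta> * q.\<close>

lemma bregman_dissipation:
  assumes "\<alpha> + \<beta> = 1" "0 < \<alpha>" "0 < \<beta>"
  shows "\<alpha> * \<beta> * mu / (L + 2 * mu) * bregman c uh us \<le> \<beta> * bregman c us u + \<alpha> * bregman c uh u"
proof -
  have Lh: "0 < L + 2 * mu" using mu_pos mu_le_L by simp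
  have "\<alpha> * \<beta> * mu / (L + 2 * mu) * bregman c uh us
      \<le> \<alpha> * \<beta> * mu / (L + 2 * mu) * ((L + 2 * mu) / 2 * (norm (uh - us))\<^sup>2)"
    using assms mu_pos Lh by (intro mult_left_mono bregman_upper) auto
  also have "\<dots> = mu / 2 * (\<alpha> * \<beta> * (norm (uh - us))\<^sup>2)" using Lh by simp
  also have "\<dots> \<le> mu / 2 * (\<beta> * (norm (us - u))\<^sup>2 + \<alpha> * (norm (uh - u))\<^sup>2)"
  proof -
    have "norm (uh - us) \<le> norm (us - u) + norm (uh - u)"
      using norm_triangle_ineq4[of "uh - u" "us - u"] by simp
    then have "\<alpha> * \<beta> * (norm (uh - us))\<^sup>2 \<le> \<alpha> * \<beta> * (norm (us - u) + norm (uh - u))\<^sup>2"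
      using assms by (intro mult_left_mono power_mono) auto
    also have "\<dots> \<le> \<beta> * (norm (us - u))\<^sup>2 + \<alpha> * (norm (uh - u))\<^sup>2"
    proof -
      have "\<beta> * p\<^sup>2 + \<alpha> * r\<^sup>2 - \<alpha> * \<beta> * (p + r)\<^sup>2 = (\<beta> * p - \<alpha> * r)\<^sup>2" for p r :: real
      proof -
        have \<alpha>: "\<alpha> = 1 - \<beta>" using assms by simp
        show ?thesis unfolding \<alpha> by (simp add: power2_eq_square algebra_simps)
      qed
      then show ?thesis by (metis diff_ge_0_iff_ge zero_le_power2)
    qed
    finally show ?thesis using mu_pos by (intro mult_left_mono) auto
  qed
  also have "\<dots> = \<beta> * (mu / 2 * (norm (us - u))\<^sup>2) + \<alpha> * (mu / 2 * (norm (uh - u))\<^sup>2)"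
    by (simp add: algebra_simps)
  also have "\<dots> \<le> \<beta> * bregman c us u + \<alpha> * bregman c uh u"
    using assms by (intro add_mono mult_left_mono bregman_lower) auto
  finally show ?thesis .
qed

text \<open>The second summand is the price of replacing \<^term>\<open>uh\<close> by \<^term>\<open>u\<close> in \<open>merit_bound\<close>; half of the
  proximal term \<open>\<eta> / 2 * (norm (xh - x1))\<^sup>2\<close> of \<open>primal_step\<close> absorbs the extrapolation error of the
  Bregman distance, the other half absorbs this summand.\<close>

definition merit :: "'b \<Rightarrow> 'b \<Rightarrow> 'b \<Rightarrow> 'b \<Rightarrow> real" where
  "merit c us uh u = 2 / mu * bregman c uh us + (L + 2 * mu) / mu * (norm (u - uh))\<^sup>2"

text \<open>Young's inequality with parameter q, matching the weight 1 / q of the second summand of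
  \<open>merit\<close>. Here the factor 1 + q is lost.\<close>

lemma merit_bound:
  "(norm (u - us))\<^sup>2 \<le> (1 + mu / (L + 2 * mu)) * merit c us uh u"
proof -
  define q where "q = mu / (L + 2 * mu)"
  have q: "0 < q" and q': "(L + 2 * mu) / mu = 1 / q" using mu_pos mu_le_L by (auto simp: q_def)
  have tri: "norm (u - us) \<le> norm (uh - us) + norm (u - uh)"
    using norm_triangle_ineq[of "uh - us" "u - uh"] by simp
  have "(norm (u - us))\<^sup>2 \<le> (norm (uh - us) + norm (u - uh))\<^sup>2"
    using tri by (intro power_mono) auto
  also have "\<dots> \<le> (1 + q) * ((norm (uh - us))\<^sup>2 + 1 / q * (norm (u - uh))\<^sup>2)"
  proof -
    have "(1 + q) * (a\<^sup>2 + 1 / q * b\<^sup>2) - (a + b)\<^sup>2 = (q * a - b)\<^sup>2 / q" for a b :: real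
      using q by (simp add: power2_eq_square field_simps)
    moreover have "0 \<le> (q * a - b)\<^sup>2 / q" for a b using q by simp
    ultimately show ?thesis by (metis diff_ge_0_iff_ge)
  qed
  also have "\<dots> \<le> (1 + q) * merit c us uh u"
  proof -
    have "(norm (uh - us))\<^sup>2 \<le> 2 / mu * bregman c uh us"
      using bregman_lower[of uh us c] mu_pos by (simp add: field_simps)
    then show ?thesis unfolding merit_def q' using q by (intro mult_left_mono) auto
  qed
  finally show ?thesis by (simp add: q_def)
qed

lemma upd_blk_diff: "upd_blk (B i) x v - x = v - blk (B i) x"
  by (simp add: upd_blk_def)

text \<open>An update of block i changes only its own contribution to the squared distance. Over the
  m - 1 choices, each new block therefore counts once and each old block m - 2 times.\<close>

lemma sum_dist_upd_blk:
  assumes "\<And>i. i \<in> I \<Longrightarrow> v i \<in> span (B i)"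
  shows "(\<Sum>i\<in>I. (norm (upd_blk (B i) x (v i) - z))\<^sup>2)
    = (norm ((\<Sum>i\<in>I. v i) - z))\<^sup>2 + (real m - 2) * (norm (x - z))\<^sup>2"
proof -
  have 1: "(norm (upd_blk (B i) x (v i) - z))\<^sup>2
      = (norm (v i - blk (B i) z))\<^sup>2 + ((norm (x - z))\<^sup>2 - (norm (blk (B i) (x - z)))\<^sup>2)" if i: "i \<in> I" for i
  proof -
    have b: "blk (B j) (upd_blk (B i) x (v i) - z) = (if j = i then v i - blk (B i) z else blk (B j) (x - z))"
      if j: "j \<in> I" for j
    proof -
      have "blk (B j) (v i) = (if j = i then v i else 0)"
        using blk_blk[OF j i, of "v i"] blk_of_span[OF B_sub'[OF i] assms[OF i]] by auto
      then show ?thesis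
        unfolding upd_blk_def linear_diff[OF linear_blk] linear_add[OF linear_blk]
        by (simp add: blk_blk[OF j i])
    qed
    have "(norm y)\<^sup>2 = (norm (blk (B i) y))\<^sup>2 + (\<Sum>j\<in>I - {i}. (norm (blk (B j) y))\<^sup>2)" for y
      unfolding norm2_blocks[of y] using i by (simp add: sum.remove)
    from this[of "upd_blk (B i) x (v i) - z"] this[of "x - z"] show ?thesis using i b by simp
  qed
  have "(norm ((\<Sum>i\<in>I. v i) - z))\<^sup>2 = (\<Sum>i\<in>I. (norm (v i - blk (B i) z))\<^sup>2)"
    unfolding norm2_blocks[of "_ - z"] linear_diff[OF linear_blk]
    by (intro sum.cong refl) (subst blk_sum[OF _ assms], auto)
  then show ?thesis
    using norm2_blocks[of "x - z"] m3 by (simp add: 1 sum.distrib sum_subtractf algebra_simps of_nat_diff)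
qed

text \<open>The sum over i divided by N is the expectation over the next index. The extrapolation
  carries the factor N, so its average equals \<beta> times the displacement of the full update, and
  the linear terms fit those of \<open>primal_step\<close> and \<open>dual_step\<close>.\<close>

lemma inner_step:
  fixes x1 :: 'a and uh :: 'b and \<alpha> \<beta> \<eta> N :: real
  assumes opt: "is_sub_opt xb xbm xs us"
    and \<alpha>\<beta>: "\<alpha> + \<beta> = 1" "0 < \<alpha>" "0 < \<beta>" and N: "N = real m - 1"
    and \<eta>: "2 * (L + 2 * mu) * \<beta> * N * (Abar m B A)\<^sup>2 = \<eta>"
  defines "u \<equiv> \<alpha> *\<^sub>R uh + \<beta> *\<^sub>R (bv - A x1)"
  defines "v \<equiv> prox \<eta> xb (- g\<psi>m xbm u) x1"
  shows "(\<Sum>i\<in>I. merit xbm us (u - (\<beta> * N) *\<^sub>R A (upd_blk (B i) x1 (v i) - x1)) u) / N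
      + \<beta> * (\<eta> + 2 * mu) / mu * (norm ((\<Sum>i\<in>I. v i) - xs))\<^sup>2
    \<le> \<alpha> * (1 - \<beta> * mu / (L + 2 * mu)) * (2 / mu * bregman xbm uh us)
      + \<beta> * \<eta> / mu * (norm (x1 - xs))\<^sup>2"
proof -
  define Lh where "Lh = L + 2 * mu"
  have Lh: "0 < Lh" using mu_pos mu_le_L by (simp add: Lh_def)
  have N0: "0 < N" using m3 N by simp
  have \<eta>0: "0 \<le> \<eta>" using \<alpha>\<beta> N0 Lh \<eta> by (auto simp: Lh_def[symmetric])
  define xh where "xh = (\<Sum>i\<in>I. v i)"
  define w where "w i = v i - blk (B i) x1" for i
  define g where "g = g\<psi>m xbm u - g\<psi>m xbm us"
  define Ab where "Ab = Abar m B A"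
  have wspan: "w i \<in> span (B i)" if "i \<in> I" for i
    unfolding w_def v_def using prox_spec(1)[OF that \<eta>0] X_sub that by (intro span_diff blk_in_span) blast
  have vspan: "v i \<in> span (B i)" if "i \<in> I" for i
    unfolding v_def using prox_spec(1)[OF that \<eta>0] X_sub that by blast
  have sum_w: "(\<Sum>i\<in>I. w i) = xh - x1"
    by (simp add: w_def xh_def sum_subtractf sum_blk)
  have sum_w2: "(\<Sum>i\<in>I. (norm (w i))\<^sup>2) = (norm (xh - x1))\<^sup>2"
  proof -
    have "blk (B i) (xh - x1) = w i" if "i \<in> I" for i
    proof -
      have "blk (B i) (sum v I) = v i" by (rule blk_sum[OF that vspan])
      then show ?thesis unfolding linear_diff[OF linear_blk] w_def xh_def by simp
    qed
    then show ?thesis unfolding norm2_blocks[of "xh - x1"] by simp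
  qed
  have Aw: "(norm (A (w i)))\<^sup>2 \<le> Ab\<^sup>2 * (norm (w i))\<^sup>2" if "i \<in> I" for i
    using power_mono[OF norm_A_block[OF that wspan[OF that]], of 2] by (simp add: power_mult_distrib Ab_def)
  have cardI: "real (card I) = N" using card_I N by simp

  \<comment> \<open>Expansion around \<open>u\<close>: the quadratic error is \<open>Lh / mu\<close>
    from the Bregman distance plus the same amount from the second summand of
    \<open>merit\<close>.\<close>
  have each: "merit xbm us (u - (\<beta> * N) *\<^sub>R A (w i)) u
      \<le> 2 / mu * bregman xbm u us - 2 / mu * (\<beta> * N) * (g \<bullet> A (w i))
        + 2 * Lh / mu * ((\<beta> * N)\<^sup>2 * (Ab\<^sup>2 * (norm (w i))\<^sup>2))" if "i \<in> I" for i
  proof -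
    let ?un = "u - (\<beta> * N) *\<^sub>R A (w i)"
    have d: "(norm (?un - u))\<^sup>2 \<le> (\<beta> * N)\<^sup>2 * (Ab\<^sup>2 * (norm (w i))\<^sup>2)"
      using Aw[OF that] by (simp add: power_mult_distrib mult_left_mono)
    have gi: "g \<bullet> (?un - u) = - ((\<beta> * N) * (g \<bullet> A (w i)))" by simp
    have "2 / mu * bregman xbm ?un us + Lh / mu * (norm (u - ?un))\<^sup>2
        = 2 / mu * (bregman xbm ?un u + bregman xbm u us + g \<bullet> (?un - u)) + Lh / mu * (norm (?un - u))\<^sup>2"
      unfolding g_def bregman_three_point[of xbm ?un us u] norm_minus_commute[of u ?un] ..
    also have "\<dots> \<le> 2 / mu * (Lh / 2 * (norm (?un - u))\<^sup>2 + bregman xbm u us + g \<bullet> (?un - u)) + Lh / mu * (norm (?un - u))\<^sup>2"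
      using bregman_upper[of xbm ?un u] mu_pos unfolding Lh_def
      by (intro add_right_mono mult_left_mono) auto
    also have "\<dots> = 2 / mu * bregman xbm u us + 2 / mu * (g \<bullet> (?un - u)) + 2 * Lh / mu * (norm (?un - u))\<^sup>2"
      using mu_pos by (simp add: field_simps)
    also have "\<dots> \<le> 2 / mu * bregman xbm u us + 2 / mu * (g \<bullet> (?un - u)) + 2 * Lh / mu * ((\<beta> * N)\<^sup>2 * (Ab\<^sup>2 * (norm (w i))\<^sup>2))"
      using d Lh mu_pos by (intro add_left_mono mult_left_mono) auto
    finally show ?thesis unfolding merit_def gi Lh_def by simp
  qed
  have "(\<Sum>i\<in>I. merit xbm us (u - (\<beta> * N) *\<^sub>R A (w i)) u)
     \<le> (\<Sum>i\<in>I. 2 / mu * bregman xbm u us - 2 / mu * (\<beta> * N) * (g \<bullet> A (w i))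
        + 2 * Lh / mu * ((\<beta> * N)\<^sup>2 * (Ab\<^sup>2 * (norm (w i))\<^sup>2)))"
    by (intro sum_mono each)
  also have "\<dots> = N * (2 / mu * bregman xbm u us) - 2 / mu * (\<beta> * N) * (g \<bullet> A (xh - x1))
        + 2 * Lh / mu * ((\<beta> * N)\<^sup>2 * (Ab\<^sup>2 * (norm (xh - x1))\<^sup>2))"
  proof -
    have "g \<bullet> A (xh - x1) = (\<Sum>i\<in>I. g \<bullet> A (w i))"
      unfolding sum_w[symmetric] linear_sum[OF A_lin] inner_sum_right ..
    then show ?thesis
      unfolding sum_w2[symmetric] sum.distrib sum_subtractf sum_distrib_left[symmetric] sum_constant cardI
      by simp
  qed
  \<comment> \<open>The identity for \<eta> turns the quadratic error into precisely the proximal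
    term that \<open>primal_step\<close> supplies.\<close>
  also have "\<dots> = N * (2 / mu * bregman xbm u us - 2 / mu * \<beta> * (g \<bullet> A (xh - x1)) + \<beta> * \<eta> / mu * (norm (xh - x1))\<^sup>2)"
    unfolding \<eta>[symmetric] Lh_def[symmetric] Ab_def[symmetric] using mu_pos by (simp add: field_simps power2_eq_square)
  finally have avg: "(\<Sum>i\<in>I. merit xbm us (u - (\<beta> * N) *\<^sub>R A (w i)) u) / N
      \<le> 2 / mu * bregman xbm u us - 2 / mu * \<beta> * (g \<bullet> A (xh - x1)) + \<beta> * \<eta> / mu * (norm (xh - x1))\<^sup>2"
    using N0 by (simp add: divide_le_eq mult.commute)
  have us: "A xs + us = bv" using opt by (simp add: is_sub_opt_def)
  have dual: "bregman xbm u us + \<beta> * bregman xbm us u + \<alpha> * bregman xbm uh u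
    = \<alpha> * bregman xbm uh us - \<beta> * (g \<bullet> A (x1 - xs))"
    unfolding g_def by (rule dual_step[OF \<alpha>\<beta>(1) u_def[THEN meta_eq_to_obj_eq] us])
  have "- g \<bullet> A (xh - xs) + (\<eta> + 2 * mu) / 2 * (norm (xh - xs))\<^sup>2
      + \<eta> / 2 * (norm (xh - x1))\<^sup>2 \<le> \<eta> / 2 * (norm (x1 - xs))\<^sup>2"
    using primal_step[OF opt \<eta>0, of u x1] unfolding xh_def v_def g_def by simp
  then have primal: "\<beta> * (- g \<bullet> A (xh - xs) + (\<eta> + 2 * mu) / 2 * (norm (xh - xs))\<^sup>2
      + \<eta> / 2 * (norm (xh - x1))\<^sup>2) \<le> \<beta> * (\<eta> / 2 * (norm (x1 - xs))\<^sup>2)"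
    using \<alpha>\<beta> by (intro mult_left_mono) auto
  \<comment> \<open>The part with \<open>x1 - xs\<close> cancels against \<open>dual\<close>; the
    part with \<open>xh - x1\<close> is the linear term of \<open>avg\<close>.\<close>
  have split: "g \<bullet> A (xh - xs) = g \<bullet> A (xh - x1) + g \<bullet> A (x1 - xs)"
    by (simp add: A_diff inner_diff_right)
  have "\<beta> * (- g \<bullet> A (xh - xs) + (\<eta> + 2 * mu) / 2 * (norm (xh - xs))\<^sup>2
      + \<eta> / 2 * (norm (xh - x1))\<^sup>2) = - (\<beta> * (g \<bullet> A (xh - x1))) - \<beta> * (g \<bullet> A (x1 - xs))
      + \<beta> * (\<eta> + 2 * mu) / 2 * (norm (xh - xs))\<^sup>2 + \<beta> * \<eta> / 2 * (norm (xh - x1))\<^sup>2"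
    unfolding inner_minus_left split by (simp add: algebra_simps)
  moreover have "\<beta> * (\<eta> / 2 * (norm (x1 - xs))\<^sup>2) = \<beta> * \<eta> / 2 * (norm (x1 - xs))\<^sup>2" by simp
  moreover have "\<alpha> * (1 - \<beta> * mu / Lh) * bregman xbm uh us
      = \<alpha> * bregman xbm uh us - \<alpha> * \<beta> * mu / (L + 2 * mu) * bregman xbm uh us"
    by (simp add: Lh_def right_diff_distrib left_diff_distrib mult.assoc)
  ultimately have "bregman xbm u us - \<beta> * (g \<bullet> A (xh - x1)) + \<beta> * \<eta> / 2 * (norm (xh - x1))\<^sup>2
      + \<beta> * (\<eta> + 2 * mu) / 2 * (norm (xh - xs))\<^sup>2
      \<le> \<alpha> * (1 - \<beta> * mu / Lh) * bregman xbm uh us + \<beta> * \<eta> / 2 * (norm (x1 - xs))\<^sup>2"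
    using primal dual bregman_dissipation[OF \<alpha>\<beta>, of xbm uh us u] by linarith
  then have "2 / mu * (bregman xbm u us - \<beta> * (g \<bullet> A (xh - x1)) + \<beta> * \<eta> / 2 * (norm (xh - x1))\<^sup>2
      + \<beta> * (\<eta> + 2 * mu) / 2 * (norm (xh - xs))\<^sup>2)
      \<le> 2 / mu * (\<alpha> * (1 - \<beta> * mu / Lh) * bregman xbm uh us + \<beta> * \<eta> / 2 * (norm (x1 - xs))\<^sup>2)"
    using mu_pos by (intro mult_left_mono) auto
  then have "2 / mu * bregman xbm u us - 2 / mu * \<beta> * (g \<bullet> A (xh - x1)) + \<beta> * \<eta> / mu * (norm (xh - x1))\<^sup>2
      + \<beta> * (\<eta> + 2 * mu) / mu * (norm (xh - xs))\<^sup>2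
      \<le> \<alpha> * (1 - \<beta> * mu / Lh) * (2 / mu * bregman xbm uh us) + \<beta> * \<eta> / mu * (norm (x1 - xs))\<^sup>2"
  proof -
    have "2 / mu * (D - \<beta> * e + \<beta> * \<eta> / 2 * p + \<beta> * (\<eta> + 2 * mu) / 2 * r)
        = 2 / mu * D - 2 / mu * \<beta> * e + \<beta> * \<eta> / mu * p + \<beta> * (\<eta> + 2 * mu) / mu * r" for D e p r
      using mu_pos by (simp add: field_simps)
    moreover have "2 / mu * (K * D + \<beta> * \<eta> / 2 * p) = K * (2 / mu * D) + \<beta> * \<eta> / mu * p" for K D p
      using mu_pos by (simp add: field_simps)
    moreover assume "2 / mu * (bregman xbm u us - \<beta> * (g \<bullet> A (xh - x1)) + \<beta> * \<eta> / 2 * (norm (xh - x1))\<^sup>2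
      + \<beta> * (\<eta> + 2 * mu) / 2 * (norm (xh - xs))\<^sup>2)
      \<le> 2 / mu * (\<alpha> * (1 - \<beta> * mu / Lh) * bregman xbm uh us + \<beta> * \<eta> / 2 * (norm (x1 - xs))\<^sup>2)"
    ultimately show ?thesis by simp
  qed
  then show ?thesis using avg unfolding upd_blk_diff w_def xh_def Lh_def by simp
qed

section \<open>The Lyapunov function along one run of RaDual\<close>

abbreviation \<alpha> :: real where "\<alpha> \<equiv> rap_alpha m mu L (Abar m B A)"
abbreviation \<eta> :: real where "\<eta> \<equiv> rap_eta m mu \<alpha>"
abbreviation steps :: nat where "steps \<equiv> rap_s mu L \<alpha>"
abbreviation q :: real where "q \<equiv> mu / (L + 2 * mu)"

abbreviation inner_run :: "'a \<Rightarrow> 'b \<Rightarrow> (nat \<Rightarrow> nat) \<Rightarrow> nat \<Rightarrow> 'a \<times> 'a \<times> 'b \<times> 'b" where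
  "inner_run xb xbm idx \<equiv> radual m B Xs A bv f gfm mu ((real m - 1) * \<alpha>) (rap_tau \<alpha>) \<eta> xb xbm idx"

lemma q_bounds: "0 < q" "q \<le> 1 / 3"
  using mu_pos mu_le_L by (auto simp: field_simps)

lemma \<alpha>_bounds: "1 / 2 \<le> \<alpha>" "\<alpha> < 1"
proof -
  obtain z where z: "0 < z" "z \<le> 1" "1 - \<alpha> = z / (real m - 1)"
    using rap_parameters[OF m3 mu_pos mu_le_L] by metis
  moreover have "z / (real m - 1) \<le> 1 / 2" using z m3 by (intro frac_le) auto
  moreover have "0 < z / (real m - 1)" using z m3 by simp
  ultimately show "1 / 2 \<le> \<alpha>" "\<alpha> < 1" by linarith+
qed

text \<open>The dual iterate is \<open>- g\<close>. The factor m - 1 compensates for the fact that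
  only one of m - 1 blocks moves per step.\<close>

definition extrap :: "'a \<Rightarrow> 'a \<Rightarrow> 'b \<Rightarrow> 'b" where
  "extrap x1 x2 g = - g - ((1 - \<alpha>) * (real m - 1)) *\<^sub>R A (x1 - x2)"

definition next_u :: "'a \<Rightarrow> 'a \<Rightarrow> 'b \<Rightarrow> 'b" where
  "next_u x1 x2 g = \<alpha> *\<^sub>R extrap x1 x2 g + (1 - \<alpha>) *\<^sub>R (bv - A x1)"

text \<open>Since 1 / (1 + \<tau>) = 1 - \<alpha>, the primal extrapolation inside the dual update
  can be read as an extrapolation of the dual iterate itself. This puts the new iterate in the form
  required by \<open>dual_step\<close>.\<close>

lemma inner_run_Suc:
  assumes "inner_run xb xbm idx t = (x1, x2, g, y)"
  shows "inner_run xb xbm idx (Suc t) =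
    (upd_blk (B (idx (Suc t))) x1 (prox \<eta> xb (- g\<psi>m xbm (next_u x1 x2 g)) x1 (idx (Suc t))), x1,
     - next_u x1 x2 g, - g\<psi>m xbm (next_u x1 x2 g))"
proof -
  have \<tau>: "1 / (1 + rap_tau \<alpha>) = 1 - \<alpha>" "(1 - \<alpha>) * rap_tau \<alpha> = \<alpha>"
    using \<alpha>_bounds by (auto simp: rap_tau_def field_simps)
  have "(1 / (1 + rap_tau \<alpha>)) *\<^sub>R (rap_tau \<alpha> *\<^sub>R g + A (((real m - 1) * \<alpha>) *\<^sub>R (x1 - x2) + x1) - bv)
      = \<alpha> *\<^sub>R g + ((1 - \<alpha>) * ((real m - 1) * \<alpha>)) *\<^sub>R A (x1 - x2) + (1 - \<alpha>) *\<^sub>R (A x1 - bv)"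
    unfolding \<tau>(1) linear_add[OF A_lin] linear_cmul[OF A_lin]
    by (simp add: scaleR_add_right scaleR_diff_right \<tau>(2))
  also have "\<dots> = - next_u x1 x2 g"
    unfolding next_u_def extrap_def by (simp add: scaleR_diff_right mult_ac)
  finally have g': "(1 / (1 + rap_tau \<alpha>)) *\<^sub>R (rap_tau \<alpha> *\<^sub>R g + A (((real m - 1) * \<alpha>) *\<^sub>R (x1 - x2) + x1) - bv)
      = - next_u x1 x2 g" .
  show ?thesis
    unfolding radual.simps assms Let_def prod.case g' prox_def prox_obj_def g\<psi>m_def minus_minus ..
qed

definition lyap :: "'b \<Rightarrow> 'a \<Rightarrow> 'b \<Rightarrow> real \<Rightarrow> 'a \<times> 'a \<times> 'b \<times> 'b \<Rightarrow> real" where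
  "lyap xbm xs us w st = (case st of (x1, x2, g, y) \<Rightarrow>
     merit xbm us (extrap x1 x2 g) (- g) + w * (norm (x1 - xs))\<^sup>2)"

text \<open>Averaging the new squared distance gives b / N + (1 - 1 / N) * a. The hypotheses on
  \<open>w'\<close> and \<open>w\<close> compare the coefficients of b and of a with those of
  \<open>inner_step\<close>.\<close>

lemma lyap_step:
  assumes opt: "is_sub_opt xb xbm xs us"
    and z: "0 < z" "z \<le> 1" "1 - \<alpha> = z / (real m - 1)" "\<eta> = mu * (1 - z) / z"
    and z\<eta>: "2 * (L + 2 * mu) * (z / (real m - 1)) * (real m - 1) * (Abar m B A)\<^sup>2 = mu * (1 - z) / z"
    and \<rho>: "1 - (1 - \<alpha>) * q \<le> \<rho>" and w': "w' \<le> 1 + z"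
    and ww': "w' * (1 - 1 / (real m - 1)) + (1 - z) / (real m - 1) \<le> \<alpha> * \<rho> * w"
    and next_st: "\<And>i. i \<in> I \<Longrightarrow> st' i =
      (upd_blk (B i) x1 (prox \<eta> xb (- g\<psi>m xbm (next_u x1 x2 g)) x1 i), x1, - next_u x1 x2 g, y' i)"
  shows "(\<Sum>i\<in>I. lyap xbm xs us w' (st' i)) \<le> (real m - 1) * (\<alpha> * \<rho> * lyap xbm xs us w (x1, x2, g, y))"
proof -
  define N where "N = real m - 1"
  define \<beta> where "\<beta> = 1 - \<alpha>"
  define u where "u = next_u x1 x2 g"
  define uh where "uh = extrap x1 x2 g"
  define v where "v = prox \<eta> xb (- g\<psi>m xbm u) x1"
  define a where "a = (norm (x1 - xs))\<^sup>2"
  define b where "b = (norm ((\<Sum>i\<in>I. v i) - xs))\<^sup>2"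
  have N: "2 \<le> N" using m3 by (simp add: N_def)
  have \<beta>: "\<beta> = z / N" using z by (simp add: \<beta>_def N_def)
  have \<beta>0: "0 < \<beta>" using \<beta> z N by simp
  have \<eta>0: "0 \<le> \<eta>" using z mu_pos by simp
  have vspan: "v i \<in> span (B i)" if "i \<in> I" for i
    unfolding v_def using prox_spec(1)[OF that \<eta>0] X_sub that by blast
  have P: "0 \<le> 2 / mu * bregman xbm uh us"
    using mu_pos order.trans[OF _ bregman_lower[of uh us xbm]] by simp
  have u: "u = \<alpha> *\<^sub>R uh + \<beta> *\<^sub>R (bv - A x1)" by (simp add: u_def uh_def next_u_def \<beta>_def)
  have "2 * (L + 2 * mu) * \<beta> * N * (Abar m B A)\<^sup>2 = \<eta>"
    using z\<eta> z(4) unfolding \<beta> N_def by simp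
  moreover have "\<alpha> + \<beta> = 1" "0 < \<alpha>" using \<alpha>_bounds by (auto simp: \<beta>_def)
  ultimately have step: "(\<Sum>i\<in>I. merit xbm us (u - (\<beta> * N) *\<^sub>R A (upd_blk (B i) x1 (v i) - x1)) u) / N
      + \<beta> * (\<eta> + 2 * mu) / mu * b \<le> \<alpha> * (1 - \<beta> * mu / (L + 2 * mu)) * (2 / mu * bregman xbm uh us)
      + \<beta> * \<eta> / mu * a"
    using inner_step[OF opt _ _ \<beta>0 N_def, of \<alpha> \<eta> uh x1] unfolding a_def b_def v_def u by blast
  have coeffs: "\<beta> * (\<eta> + 2 * mu) / mu = (1 + z) / N" "\<beta> * \<eta> / mu = (1 - z) / N"
    unfolding \<beta> z(4) using z mu_pos N by (auto simp: field_simps)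
  have step': "(\<Sum>i\<in>I. merit xbm us (u - (\<beta> * N) *\<^sub>R A (upd_blk (B i) x1 (v i) - x1)) u) / N
      + (1 + z) / N * b \<le> \<alpha> * (1 - \<beta> * mu / (L + 2 * mu)) * (2 / mu * bregman xbm uh us) + (1 - z) / N * a"
    using step unfolding coeffs .
  have dist: "(\<Sum>i\<in>I. (norm (upd_blk (B i) x1 (v i) - xs))\<^sup>2) = b + (N - 1) * a"
    using sum_dist_upd_blk[OF vspan, of x1 xs] by (simp add: a_def b_def N_def)
  have "(\<Sum>i\<in>I. lyap xbm xs us w' (st' i))
    = (\<Sum>i\<in>I. merit xbm us (u - (\<beta> * N) *\<^sub>R A (upd_blk (B i) x1 (v i) - x1)) u) + w' * (b + (N - 1) * a)"
    unfolding dist[symmetric] sum_distrib_left sum.distrib[symmetric]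
  proof (rule sum.cong[OF refl])
    fix i assume "i \<in> I"
    show "lyap xbm xs us w' (st' i) = merit xbm us (u - (\<beta> * N) *\<^sub>R A (upd_blk (B i) x1 (v i) - x1)) u
      + w' * (norm (upd_blk (B i) x1 (v i) - xs))\<^sup>2"
      unfolding next_st[OF \<open>i \<in> I\<close>] lyap_def prod.case extrap_def minus_minus
      by (simp add: u_def v_def \<beta>_def N_def)
  qed
  also have "\<dots> \<le> N * (\<alpha> * \<rho> * (2 / mu * bregman xbm uh us + w * a))"
  proof -
    have "\<alpha> * (1 - \<beta> * mu / (L + 2 * mu)) * (2 / mu * bregman xbm uh us) \<le> \<alpha> * \<rho> * (2 / mu * bregman xbm uh us)"
      using \<rho> \<alpha>_bounds P unfolding \<beta>_def by (intro mult_right_mono mult_left_mono) auto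
    moreover have "w' / N * b \<le> (1 + z) / N * b"
      using w' N by (intro mult_right_mono divide_right_mono) (auto simp: b_def)
    moreover have "(w' * (1 - 1 / N) + (1 - z) / N) * a \<le> \<alpha> * \<rho> * w * a"
      using ww' by (intro mult_right_mono) (auto simp: a_def N_def)
    ultimately have "(\<Sum>i\<in>I. merit xbm us (u - (\<beta> * N) *\<^sub>R A (upd_blk (B i) x1 (v i) - x1)) u) / N
      + w' / N * b + w' * (1 - 1 / N) * a \<le> \<alpha> * \<rho> * (2 / mu * bregman xbm uh us) + \<alpha> * \<rho> * w * a"
      using step' by (simp add: distrib_right)
    moreover have "w' / N * b + w' * (1 - 1 / N) * a = w' * (b + (N - 1) * a) / N"
      using N by (simp add: field_simps)
    ultimately have "((\<Sum>i\<in>I. merit xbm us (u - (\<beta> * N) *\<^sub>R A (upd_blk (B i) x1 (v i) - x1)) u) + w' * (b + (N - 1) * a)) / N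
      \<le> \<alpha> * \<rho> * (2 / mu * bregman xbm uh us + w * a)"
      by (simp add: add_divide_distrib distrib_left mult.assoc)
    then show ?thesis using N by (simp add: divide_le_eq mult.commute)
  qed
  also have "\<dots> \<le> N * (\<alpha> * \<rho> * lyap xbm xs us w (x1, x2, g, y))"
  proof -
    have "0 \<le> \<rho>"
    proof -
      have "q \<le> 1" using q_bounds by linarith
      then have "(1 - \<alpha>) * q \<le> 1 * 1"
        using \<alpha>_bounds q_bounds(1) by (intro mult_mono order.strict_implies_order[OF q_bounds(1)]) auto
      then show ?thesis using \<rho> by simp
    qed
    \<comment> \<open>The second summand of the old merit is simply dropped; it matters only for the
      final iterate.\<close>
    moreover have "2 / mu * bregman xbm uh us \<le> merit xbm us uh (- g)"
      unfolding merit_def using mu_pos mu_le_L by simp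
    ultimately show ?thesis
      using N \<alpha>_bounds unfolding lyap_def prod.case uh_def[symmetric] a_def[symmetric]
      by (intro mult_left_mono add_right_mono) auto
  qed
  finally show ?thesis by (simp add: N_def)
qed

lemma steps_bounds:
  "\<alpha> ^ steps / q \<le> 1 / max 2 (L\<^sup>2 / mu\<^sup>2)" "\<alpha> ^ steps \<le> 1 / 6" "0 < steps"
proof -
  have \<alpha>: "0 < \<alpha>" "\<alpha> < 1" using \<alpha>_bounds by auto
  show "\<alpha> ^ steps / q \<le> 1 / max 2 (L\<^sup>2 / mu\<^sup>2)" "\<alpha> ^ steps \<le> 1 / 6"
    using rap_s_bound[OF mu_pos mu_le_L \<alpha>] by (simp_all add: field_simps)
  then show "0 < steps" by (cases "steps = 0") auto
qed

text \<open>The last \<open>y\<close> equals \<open>- g\<psi>m xbm (- g)\<close>, so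
  \<open>- g\<close> is the unique minimiser of a strongly convex objective and the choice must
  return it. The condition \<open>0 < t\<close> excludes the dummy initial \<open>y\<close>.\<close>

lemma radual_out_eq:
  assumes "0 < t" and st: "inner_run xb xbm idx t = (x1, x2, g, y)"
  shows "radual_out m B Xs A bv f fm gfm mu ((real m - 1) * \<alpha>) (rap_tau \<alpha>) \<eta> xb xbm idx t = (x1, - g)"
proof -
  obtain t' where t': "t = Suc t'" using \<open>0 < t\<close> by (cases t) auto
  obtain x1' x2' g' y' where "inner_run xb xbm idx t' = (x1', x2', g', y')" by (cases "inner_run xb xbm idx t'")
  from st[unfolded t' inner_run_Suc[OF this]] have y: "y = - g\<psi>m xbm (- g)" by auto
  define obj where "obj u = fm u + mu * (norm (u - xbm))\<^sup>2 + u \<bullet> y" for u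
  have grow: "obj (- g) + mu / 2 * (norm (u + g))\<^sup>2 \<le> obj u" for u
    using \<psi>m_lower[of xbm "- g" u] unfolding obj_def \<psi>m_def[symmetric] y
    by (simp add: inner_add_left inner_add_right inner_commute)
  have "(SOME u. \<forall>w. obj u \<le> obj w) = - g"
  proof (rule some_equality)
    show "\<forall>w. obj (- g) \<le> obj w"
    proof
      fix w show "obj (- g) \<le> obj w"
      proof -
        have "0 \<le> mu / 2 * (norm (w + g))\<^sup>2" using mu_pos by simp
        then show ?thesis using grow[of w] by linarith
      qed
    qed
    fix u assume "\<forall>w. obj u \<le> obj w"
    then have "mu / 2 * (norm (u + g))\<^sup>2 \<le> 0" using grow[of u] by (meson add_le_same_cancel1 order.trans)
    then have "norm (u + g) = 0" using mu_pos by (simp add: mult_le_0_iff)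
    then show "u = - g" by (simp add: eq_neg_iff_add_eq_0)
  qed
  then show ?thesis unfolding radual_out_def st Let_def prod.case obj_def by simp
qed

definition outer_run :: "'a \<Rightarrow> 'b \<Rightarrow> (nat \<times> nat \<Rightarrow> nat) \<Rightarrow> nat \<Rightarrow> 'a \<times> 'b" where
  "outer_run x0 xm0 = rapdual m B Xs A bv f fm gfm mu ((real m - 1) * \<alpha>) (rap_tau \<alpha>) \<eta> steps x0 xm0"

definition sub_sol :: "'a \<times> 'b \<Rightarrow> 'a \<times> 'b" where
  "sub_sol c = sub_opt m B Xs A bv f fm mu (fst c) (snd c)"

definition sqdist :: "'a \<times> 'b \<Rightarrow> 'a \<times> 'b \<Rightarrow> real" where
  "sqdist p r = (norm (fst p - fst r))\<^sup>2 + (norm (snd p - snd r))\<^sup>2"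

text \<open>All tables of drawn indices are equally likely, so expectations are finite sums up to
  the factor \<open>card (samples k)\<close>.\<close>

abbreviation samples :: "nat \<Rightarrow> (nat \<times> nat \<Rightarrow> nat) set" where
  "samples k \<equiv> ({1..k} \<times> {1..steps}) \<rightarrow>\<^sub>E I"

text \<open>The initial conversion costs 1 / q and the final one 1 + q, against a decay of (\<alpha>
  * \<rho>)^s. The weights give (1 + q) * \<rho>^s \<le> 1, and the choice of s makes \<alpha>^s / q
  small enough.\<close>

lemma inner_expectation:
  assumes l: "l < k"
  shows "(\<Sum>\<omega>\<in>samples k. sqdist (outer_run x0 xm0 \<omega> (Suc l)) (sub_sol (outer_run x0 xm0 \<omega> l)))
    \<le> 1 / max 2 (L\<^sup>2 / mu\<^sup>2)
      * (\<Sum>\<omega>\<in>samples k. sqdist (outer_run x0 xm0 \<omega> l) (sub_sol (outer_run x0 xm0 \<omega> l)))"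
proof -
  define N where "N = real m - 1"
  have N: "2 \<le> N" using m3 by (simp add: N_def)
  obtain z where z: "0 < z" "z \<le> 1" "1 - \<alpha> = z / (real m - 1)" "\<eta> = mu * (1 - z) / z"
    "2 * (L + 2 * mu) * (z / (real m - 1)) * (real m - 1) * (Abar m B A)\<^sup>2 = mu * (1 - z) / z"
    using rap_parameters[OF m3 mu_pos mu_le_L] by metis
  obtain \<rho> and w :: "nat \<Rightarrow> real" where w: "1 - (1 - \<alpha>) * q \<le> \<rho>" "(1 + q) * \<rho> ^ steps \<le> 1"
    "\<And>t. w t \<le> 1 + z"
    "\<And>t. t < steps \<Longrightarrow> w (Suc t) * (1 - 1 / (real m - 1)) + (1 - z) / (real m - 1) \<le> \<alpha> * \<rho> * w t"
    "w 0 \<le> 1 + q" "1 \<le> w steps"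
    using lyapunov_weights[OF z(1,2) N[unfolded N_def] z(3), of \<alpha> q steps] q_bounds steps_bounds(2) by (simp, metis)
  have \<rho>0: "0 \<le> \<rho>"
  proof -
    have "q \<le> 1" using q_bounds by linarith
    then have "(1 - \<alpha>) * q \<le> 1 * 1"
      using \<alpha>_bounds by (intro mult_mono order.strict_implies_order[OF q_bounds(1)]) auto
    then show ?thesis using w(1) by simp
  qed
  define c where "c \<omega> = outer_run x0 xm0 \<omega> l" for \<omega>
  define xs where "xs \<omega> = fst (sub_sol (c \<omega>))" for \<omega>
  define us where "us \<omega> = snd (sub_sol (c \<omega>))" for \<omega>
  define st where "st \<omega> t = inner_run (fst (c \<omega>)) (snd (c \<omega>)) (\<lambda>t. \<omega> (Suc l, t)) t" for \<omega> t
  define Z where "Z t \<omega> = lyap (snd (c \<omega>)) (xs \<omega>) (us \<omega>) (w t) (st \<omega> t)" for t \<omega>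
  have opt: "is_sub_opt (fst (c \<omega>)) (snd (c \<omega>)) (xs \<omega>) (us \<omega>)" for \<omega>
    unfolding xs_def us_def sub_sol_def by (rule sub_opt_spec)
  \<comment> \<open>The centre and the solution of the current subproblem depend on earlier rounds
    only, so they stay fixed while an index of this round is redrawn.\<close>
  have c_upd: "c (fun_upd \<omega> (Suc l, t) i) = c \<omega>" for \<omega> t i
    unfolding c_def outer_run_def by (rule rapdual_cong) auto

  have step: "(\<Sum>\<omega>\<in>samples k. Z (Suc t) \<omega>) \<le> \<alpha> * \<rho> * (\<Sum>\<omega>\<in>samples k. Z t \<omega>)" if t: "t < steps" for t
  proof -
    let ?j = "(Suc l, Suc t)"
    have "N * (\<Sum>\<omega>\<in>samples k. Z (Suc t) \<omega>) = (\<Sum>\<omega>\<in>samples k. \<Sum>i\<in>I. Z (Suc t) (fun_upd \<omega> ?j i))"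
      unfolding N_def card_I[symmetric] using l t by (intro sum_PiE_resample[symmetric]) auto
    also have "\<dots> \<le> (\<Sum>\<omega>\<in>samples k. N * (\<alpha> * \<rho> * Z t \<omega>))"
    proof (rule sum_mono)
      fix \<omega>
      obtain x1 x2 g y where s: "st \<omega> t = (x1, x2, g, y)" by (cases "st \<omega> t")
      have st_upd: "st (fun_upd \<omega> ?j i) t = (x1, x2, g, y)" for i
        unfolding s[symmetric] st_def c_upd by (rule radual_cong) auto
      have xs_upd: "xs (fun_upd \<omega> ?j i) = xs \<omega>" "us (fun_upd \<omega> ?j i) = us \<omega>" for i
        unfolding xs_def us_def c_upd by auto
      have "(\<Sum>i\<in>I. lyap (snd (c \<omega>)) (xs \<omega>) (us \<omega>) (w (Suc t)) (st (fun_upd \<omega> ?j i) (Suc t)))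
        \<le> (real m - 1) * (\<alpha> * \<rho> * lyap (snd (c \<omega>)) (xs \<omega>) (us \<omega>) (w t) (x1, x2, g, y))"
      proof (rule lyap_step[OF opt z w(1) w(3) w(4)[OF t]])
        fix i
        show "st (fun_upd \<omega> ?j i) (Suc t) =
          (upd_blk (B i) x1 (prox \<eta> (fst (c \<omega>)) (- g\<psi>m (snd (c \<omega>)) (next_u x1 x2 g)) x1 i), x1, - next_u x1 x2 g,
            - g\<psi>m (snd (c \<omega>)) (next_u x1 x2 g))"
          using inner_run_Suc[OF st_upd[of i, unfolded st_def c_upd]] unfolding st_def c_upd by simp
      qed
      then show "(\<Sum>i\<in>I. Z (Suc t) (fun_upd \<omega> ?j i)) \<le> N * (\<alpha> * \<rho> * Z t \<omega>)"
        unfolding Z_def c_upd xs_upd s N_def .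
    qed
    also have "\<dots> = N * (\<alpha> * \<rho> * (\<Sum>\<omega>\<in>samples k. Z t \<omega>))" by (simp add: sum_distrib_left)
    finally show ?thesis using N by simp
  qed
  have decay: "(\<Sum>\<omega>\<in>samples k. Z t \<omega>) \<le> (\<alpha> * \<rho>) ^ t * (\<Sum>\<omega>\<in>samples k. Z 0 \<omega>)" if "t \<le> steps" for t
    using that
  proof (induction t)
    case (Suc t)
    have "(\<Sum>\<omega>\<in>samples k. Z (Suc t) \<omega>) \<le> \<alpha> * \<rho> * (\<Sum>\<omega>\<in>samples k. Z t \<omega>)" using Suc by (intro step) auto
    also have "\<dots> \<le> \<alpha> * \<rho> * ((\<alpha> * \<rho>) ^ t * (\<Sum>\<omega>\<in>samples k. Z 0 \<omega>))"
      using Suc \<rho>0 \<alpha>_bounds by (intro mult_left_mono) auto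
    finally show ?case by (simp add: mult_ac)
  qed simp

  have final: "sqdist (outer_run x0 xm0 \<omega> (Suc l)) (sub_sol (c \<omega>)) \<le> (1 + q) * Z steps \<omega>" for \<omega>
  proof -
    obtain x1 x2 g y where s: "st \<omega> steps = (x1, x2, g, y)" by (cases "st \<omega> steps")
    have "outer_run x0 xm0 \<omega> (Suc l)
        = radual_out m B Xs A bv f fm gfm mu ((real m - 1) * \<alpha>) (rap_tau \<alpha>) \<eta> (fst (c \<omega>)) (snd (c \<omega>)) (\<lambda>t. \<omega> (Suc l, t)) steps"
      unfolding outer_run_def c_def by (simp add: case_prod_beta)
    also have "\<dots> = (x1, - g)" by (rule radual_out_eq[OF steps_bounds(3) s[unfolded st_def]])
    finally have out: "outer_run x0 xm0 \<omega> (Suc l) = (x1, - g)" .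
    have "1 * (norm (x1 - xs \<omega>))\<^sup>2 \<le> (1 + q) * w steps * (norm (x1 - xs \<omega>))\<^sup>2"
      using w(6) q_bounds(1) mult_mono[of 1 "1 + q" 1 "w steps"] by (intro mult_right_mono) auto
    then show ?thesis
      unfolding out Z_def s sqdist_def lyap_def prod.case fst_conv snd_conv xs_def[symmetric] us_def[symmetric]
      using merit_bound[of "- g" "us \<omega>" "snd (c \<omega>)" "extrap x1 x2 g"] by (simp add: distrib_left mult.assoc)
  qed
  have init: "Z 0 \<omega> \<le> 1 / q * sqdist (c \<omega>) (sub_sol (c \<omega>))" for \<omega>
  proof -
    have s: "st \<omega> 0 = (fst (c \<omega>), fst (c \<omega>), - snd (c \<omega>), 0)" by (simp add: st_def)
    \<comment> \<open>The run starts with two equal primal points, so nothing is extrapolated and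
      the second summand of \<open>merit\<close> vanishes.\<close>
    have e: "extrap (fst (c \<omega>)) (fst (c \<omega>)) (- snd (c \<omega>)) = snd (c \<omega>)"
      using linear_0[OF A_lin] by (simp add: extrap_def)
    have "2 / mu * bregman (snd (c \<omega>)) (snd (c \<omega>)) (us \<omega>)
        \<le> 2 / mu * ((L + 2 * mu) / 2 * (norm (snd (c \<omega>) - us \<omega>))\<^sup>2)"
      using mu_pos by (intro mult_left_mono bregman_upper) auto
    moreover have "3 \<le> 1 / q" using mu_pos mu_le_L by (simp add: field_simps)
    then have "w 0 \<le> 1 / q" using w(5) q_bounds by linarith
    then have "w 0 * (norm (fst (c \<omega>) - xs \<omega>))\<^sup>2 \<le> 1 / q * (norm (fst (c \<omega>) - xs \<omega>))\<^sup>2"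
      by (intro mult_right_mono) auto
    ultimately show ?thesis
      unfolding Z_def s lyap_def prod.case merit_def e sqdist_def xs_def[symmetric] us_def[symmetric]
      by (simp add: distrib_left)
  qed

  have "(\<Sum>\<omega>\<in>samples k. sqdist (outer_run x0 xm0 \<omega> (Suc l)) (sub_sol (c \<omega>)))
     \<le> (\<Sum>\<omega>\<in>samples k. (1 + q) * Z steps \<omega>)" by (intro sum_mono final)
  also have "\<dots> = (1 + q) * (\<Sum>\<omega>\<in>samples k. Z steps \<omega>)" by (simp add: sum_distrib_left)
  also have "\<dots> \<le> (1 + q) * ((\<alpha> * \<rho>) ^ steps * (\<Sum>\<omega>\<in>samples k. Z 0 \<omega>))"
    using decay[of steps] q_bounds by (intro mult_left_mono) auto
  also have "\<dots> \<le> (1 + q) * ((\<alpha> * \<rho>) ^ steps * (\<Sum>\<omega>\<in>samples k. 1 / q * sqdist (c \<omega>) (sub_sol (c \<omega>))))"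
    using q_bounds \<rho>0 \<alpha>_bounds by (intro mult_left_mono sum_mono init) auto
  also have "\<dots> = ((1 + q) * \<rho> ^ steps) * (\<alpha> ^ steps / q * (\<Sum>\<omega>\<in>samples k. sqdist (c \<omega>) (sub_sol (c \<omega>))))"
    unfolding sum_distrib_left[symmetric] power_mult_distrib by simp
  also have "\<dots> \<le> 1 * (1 / max 2 (L\<^sup>2 / mu\<^sup>2) * (\<Sum>\<omega>\<in>samples k. sqdist (c \<omega>) (sub_sol (c \<omega>))))"
  proof -
    have "0 \<le> (\<Sum>\<omega>\<in>samples k. sqdist (c \<omega>) (sub_sol (c \<omega>)))"
      by (intro sum_nonneg) (simp add: sqdist_def)
    moreover have "0 \<le> \<alpha> ^ steps / q"
      using q_bounds(1) \<alpha>_bounds by (intro divide_nonneg_pos zero_le_power) auto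
    ultimately show ?thesis
      using w(2) steps_bounds(1) by (intro mult_mono mult_right_mono mult_nonneg_nonneg) auto
  qed
  finally show ?thesis unfolding c_def by simp
qed

section \<open>The outer iteration\<close>

lemma sub_sol_opt: "is_sub_opt (fst c) (snd c) (fst (sub_sol c)) (snd (sub_sol c))"
  unfolding sub_sol_def by (rule sub_opt_spec)

definition multiplier :: "'a \<times> 'b \<Rightarrow> 'b" where
  "multiplier c = - g\<psi>m (snd c) (snd (sub_sol c))"

text \<open>Optimality of the subproblem places \<open>- p\<close> in the normal cone, where
  \<open>p\<close> uses the regularised gradient; replacing it by \<open>G\<close> costs 2 * mu
  times the distance to the prox-centre.\<close>

lemma stationarity:
  "(infdist (G (fst (sub_sol c)) + adjoint A (multiplier c)) (uminus ` normal_cone X (fst (sub_sol c))))\<^sup>2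
    \<le> 4 * mu\<^sup>2 * sqdist c (sub_sol c)"
proof -
  let ?xs = "fst (sub_sol c)"
  define p where "p = g\<psi> (fst c) ?xs + adjoint A (multiplier c)"
  have "- p \<in> normal_cone X ?xs"
    unfolding normal_cone_def
  proof (intro CollectI ballI)
    fix y assume "y \<in> X"
    have "adjoint A (multiplier c) \<bullet> (y - ?xs) = - (g\<psi>m (snd c) (snd (sub_sol c)) \<bullet> A (y - ?xs))"
      by (simp add: adjoint_clauses[OF A_lin] multiplier_def)
    then show "- p \<bullet> (y - ?xs) \<le> 0"
      using sub_opt_variational[OF sub_sol_opt \<open>y \<in> X\<close>, of c] unfolding p_def inner_minus_left inner_add_left by simp
  qed
  then have "- (- p) \<in> uminus ` normal_cone X ?xs" by (rule imageI)
  then have "infdist (G ?xs + adjoint A (multiplier c)) (uminus ` normal_cone X ?xs)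
      \<le> dist (G ?xs + adjoint A (multiplier c)) p"
    by (intro infdist_le) simp
  also have "\<dots> = 2 * mu * norm (fst c - ?xs)"
    using mu_pos unfolding dist_norm p_def g\<psi>_def norm_minus_commute[of "fst c"] by (simp add: norm_minus_cancel)
  finally have "(infdist (G ?xs + adjoint A (multiplier c)) (uminus ` normal_cone X ?xs))\<^sup>2
      \<le> (2 * mu * norm (fst c - ?xs))\<^sup>2"
    by (intro power_mono infdist_nonneg)
  also have "\<dots> = 4 * mu\<^sup>2 * (norm (fst c - ?xs))\<^sup>2" by (simp add: power_mult_distrib)
  also have "\<dots> \<le> 4 * mu\<^sup>2 * sqdist c (sub_sol c)"
    unfolding sqdist_def by (intro mult_left_mono) auto
  finally show ?thesis .
qed

text \<open>The residual splits into a gradient difference, controlled by the Lipschitz constant,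
  and the regularisation 2 * mu * (centre - solution).\<close>

lemma multiplier_residual:
  "(norm (gfm u + multiplier c))\<^sup>2
    \<le> 8 * mu\<^sup>2 * sqdist c (sub_sol c) + 2 * L\<^sup>2 * sqdist (x, u) (sub_sol c)"
proof -
  let ?us = "snd (sub_sol c)"
  have "norm (gfm u + multiplier c) = norm ((gfm u - gfm ?us) + (2 * mu) *\<^sub>R (snd c - ?us))"
    unfolding multiplier_def g\<psi>m_def by (simp add: algebra_simps)
  also have "\<dots> \<le> norm (gfm u - gfm ?us) + norm ((2 * mu) *\<^sub>R (snd c - ?us))"
    by (rule norm_triangle_ineq)
  also have "\<dots> \<le> L * norm (u - ?us) + 2 * mu * norm (snd c - ?us)"
    using fm_lip mu_pos by (intro add_mono) auto
  finally have "(norm (gfm u + multiplier c))\<^sup>2 \<le> (L * norm (u - ?us) + 2 * mu * norm (snd c - ?us))\<^sup>2"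
    by (intro power_mono) auto
  also have "\<dots> \<le> 2 * (L * norm (u - ?us))\<^sup>2 + 2 * (2 * mu * norm (snd c - ?us))\<^sup>2"
  proof -
    have "(a + b)\<^sup>2 \<le> 2 * a\<^sup>2 + 2 * b\<^sup>2" for a b :: real
      using zero_le_power2[of "a - b"] by (simp add: power2_eq_square algebra_simps)
    then show ?thesis .
  qed
  also have "\<dots> = 2 * L\<^sup>2 * (norm (u - ?us))\<^sup>2 + 8 * mu\<^sup>2 * (norm (snd c - ?us))\<^sup>2"
    by (simp add: power_mult_distrib)
  also have "\<dots> \<le> 2 * L\<^sup>2 * sqdist (x, u) (sub_sol c) + 8 * mu\<^sup>2 * sqdist c (sub_sol c)"
    unfolding sqdist_def by (intro add_mono mult_left_mono) auto
  finally show ?thesis by simp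
qed

text \<open>The subproblem solution is feasible, so the residual is linear in the error;
  Cauchy-Schwarz in the plane gives the constant.\<close>

lemma feasibility_residual:
  "(norm (A x + u - bv))\<^sup>2 \<le> ((onorm A)\<^sup>2 + 1) * sqdist (x, u) (sub_sol c)"
proof -
  let ?xs = "fst (sub_sol c)" and ?us = "snd (sub_sol c)"
  have bv: "bv = A ?xs + ?us" using sub_sol_opt[of c] by (simp add: is_sub_opt_def)
  have "A x + u - bv = A (x - ?xs) + (u - ?us)" unfolding A_diff by (subst bv) simp
  then have "norm (A x + u - bv) \<le> norm (A (x - ?xs)) + norm (u - ?us)"
    by (simp only: norm_triangle_ineq)
  also have "\<dots> \<le> onorm A * norm (x - ?xs) + norm (u - ?us)"
    using onorm[OF A_bounded_linear] by (intro add_right_mono)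
  finally have "(norm (A x + u - bv))\<^sup>2 \<le> (onorm A * norm (x - ?xs) + norm (u - ?us))\<^sup>2"
    by (intro power_mono) auto
  also have "\<dots> \<le> ((onorm A)\<^sup>2 + 1) * ((norm (x - ?xs))\<^sup>2 + (norm (u - ?us))\<^sup>2)"
  proof -
    have "(a * p + r)\<^sup>2 \<le> (a\<^sup>2 + 1) * (p\<^sup>2 + r\<^sup>2)" for a p r :: real
      using zero_le_power2[of "a * r - p"] by (simp add: power2_eq_square algebra_simps)
    then show ?thesis .
  qed
  finally show ?thesis by (simp add: sqdist_def)
qed

definition objective :: "'a \<times> 'b \<Rightarrow> real" where
  "objective p = F (fst p) + fm (snd p)"

lemma sub_sol_descent:
  assumes "fst p \<in> X" "A (fst p) + snd p = bv"
  shows "objective (sub_sol c) + mu * sqdist c (sub_sol c) \<le> objective p + mu * sqdist c p"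
proof -
  have "\<psi> (fst c) (fst (sub_sol c)) + \<psi>m (snd c) (snd (sub_sol c)) \<le> \<psi> (fst c) (fst p) + \<psi>m (snd c) (snd p)"
    using sub_sol_opt[of c] assms unfolding is_sub_opt_def by blast
  then show ?thesis
    unfolding \<psi>_def \<psi>m_def objective_def sqdist_def norm_minus_commute[of "fst c"] norm_minus_commute[of "snd c"]
    by (simp add: distrib_left)
qed

text \<open>Each subproblem is tested at the previous subproblem solution, which is feasible,
  whereas the computed centre may violate the linear constraint. The first one is tested at its own
  centre, at distance 0.\<close>

lemma telescope:
  assumes "x0 \<in> X" "A x0 + xm0 = bv"
  shows "objective (sub_sol (outer_run x0 xm0 \<omega> n))
      + mu * (\<Sum>l\<le>n. sqdist (outer_run x0 xm0 \<omega> l) (sub_sol (outer_run x0 xm0 \<omega> l)))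
    \<le> objective (x0, xm0) + mu * (\<Sum>l<n. sqdist (outer_run x0 xm0 \<omega> (Suc l)) (sub_sol (outer_run x0 xm0 \<omega> l)))"
proof (induction n)
  case 0
  have "outer_run x0 xm0 \<omega> 0 = (x0, xm0)" by (simp add: outer_run_def)
  then show ?case using sub_sol_descent[of "(x0, xm0)" "(x0, xm0)"] assms by (simp add: sqdist_def)
next
  case (Suc n)
  let ?s = "sub_sol (outer_run x0 xm0 \<omega> n)"
  have "fst ?s \<in> X" "A (fst ?s) + snd ?s = bv" using sub_sol_opt unfolding is_sub_opt_def by auto
  from sub_sol_descent[OF this, of "outer_run x0 xm0 \<omega> (Suc n)"] Suc
  show ?case by (simp add: distrib_left)
qed

text \<open>\<open>telescope\<close> gives mu * R \<le> card * D0 + mu * E, while the contraction of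
  each round gives E \<le> \<kappa> * R. The bound \<kappa> \<le> 1 / 2 resolves this for R; the
  bound \<open>\<kappa> \<le> mu\<^sup>2 / L\<^sup>2\<close> then yields E.\<close>

lemma outer_sums:
  fixes D0 R E :: real
  assumes opt: "xstar \<in> X" "A xstar + xmstar = bv"
      "\<forall>x\<in>X. \<forall>xm. A x + xm = bv \<longrightarrow> F xstar + fm xmstar \<le> F x + fm xm"
    and init: "x0 \<in> X" "A x0 + xm0 = bv" and "1 \<le> k"
  defines "D0 \<equiv> F x0 + fm xm0 - (F xstar + fm xmstar)"
    and "R \<equiv> \<Sum>\<omega>\<in>samples k. \<Sum>l<k. sqdist (outer_run x0 xm0 \<omega> l) (sub_sol (outer_run x0 xm0 \<omega> l))"
    and "E \<equiv> \<Sum>\<omega>\<in>samples k. \<Sum>l<k. sqdist (outer_run x0 xm0 \<omega> (Suc l)) (sub_sol (outer_run x0 xm0 \<omega> l))"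
  shows "R \<le> 2 * real (card (samples k)) * D0 / mu" "E \<le> 2 * mu * real (card (samples k)) * D0 / L\<^sup>2" "0 \<le> D0"
proof -
  define r where "r \<omega> l = sqdist (outer_run x0 xm0 \<omega> l) (sub_sol (outer_run x0 xm0 \<omega> l))" for \<omega> l
  define e where "e \<omega> l = sqdist (outer_run x0 xm0 \<omega> (Suc l)) (sub_sol (outer_run x0 xm0 \<omega> l))" for \<omega> l
  define \<kappa> where "\<kappa> = 1 / max 2 (L\<^sup>2 / mu\<^sup>2)"
  have L: "0 < L" using mu_pos mu_le_L by simp
  have \<kappa>: "\<kappa> \<le> 1 / 2" unfolding \<kappa>_def by (intro divide_left_mono) auto
  have "\<kappa> \<le> 1 / (L\<^sup>2 / mu\<^sup>2)" unfolding \<kappa>_def using L mu_pos by (intro divide_left_mono) auto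
  then have \<kappa>L: "\<kappa> \<le> mu\<^sup>2 / L\<^sup>2" by simp
  have r0: "0 \<le> r \<omega> l" and e0: "0 \<le> e \<omega> l" for \<omega> l by (auto simp: r_def e_def sqdist_def)
  have R: "R = (\<Sum>\<omega>\<in>samples k. \<Sum>l<k. r \<omega> l)" and E: "E = (\<Sum>\<omega>\<in>samples k. \<Sum>l<k. e \<omega> l)"
    unfolding R_def E_def r_def e_def by auto
  have R0: "0 \<le> R" unfolding R by (intro sum_nonneg r0)
  show D0: "0 \<le> D0" using opt(3) init unfolding D0_def by auto
  have "E = (\<Sum>l<k. \<Sum>\<omega>\<in>samples k. e \<omega> l)" unfolding E by (rule sum.swap)
  also have "\<dots> \<le> (\<Sum>l<k. \<kappa> * (\<Sum>\<omega>\<in>samples k. r \<omega> l))"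
    unfolding e_def r_def \<kappa>_def by (intro sum_mono inner_expectation) auto
  also have "\<dots> = \<kappa> * R" unfolding R sum_distrib_left[symmetric] by (subst sum.swap) simp
  finally have ER: "E \<le> \<kappa> * R" .
  have "mu * (\<Sum>l<k. r \<omega> l) \<le> D0 + mu * (\<Sum>l<k. e \<omega> l)" for \<omega>
  proof -
    obtain n where n: "k = Suc n" using \<open>1 \<le> k\<close> by (cases k) auto
    let ?s = "sub_sol (outer_run x0 xm0 \<omega> n)"
    have "fst ?s \<in> X" "A (fst ?s) + snd ?s = bv" using sub_sol_opt unfolding is_sub_opt_def by auto
    \<comment> \<open>Feasibility of the last subproblem solution bounds the remaining objective
      value from below.\<close>
    then have "F xstar + fm xmstar \<le> objective ?s" using opt(3) unfolding objective_def by blast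
    moreover have "mu * (\<Sum>l<n. e \<omega> l) \<le> mu * (\<Sum>l<k. e \<omega> l)"
      unfolding n using e0 mu_pos by (intro mult_left_mono sum_mono2) auto
    moreover have "(\<Sum>l<k. r \<omega> l) = (\<Sum>l\<le>n. r \<omega> l)" unfolding n lessThan_Suc_atMost ..
    ultimately show ?thesis
      using telescope[OF init, of \<omega> n] unfolding D0_def r_def[symmetric] e_def[symmetric]
      by (simp add: objective_def)
  qed
  then have "(\<Sum>\<omega>\<in>samples k. mu * (\<Sum>l<k. r \<omega> l)) \<le> (\<Sum>\<omega>\<in>samples k. D0 + mu * (\<Sum>l<k. e \<omega> l))"
    by (rule sum_mono)
  then have main: "mu * R \<le> card (samples k) * D0 + mu * E"
    unfolding R E sum.distrib sum_distrib_left[symmetric] by simp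
  also have "mu * E \<le> mu * (1 / 2 * R)"
    using ER \<kappa> R0 mu_pos by (intro mult_left_mono order.trans[OF ER] mult_right_mono) auto
  finally have "mu * R \<le> 2 * real (card (samples k)) * D0" by simp
  then show 1: "R \<le> 2 * real (card (samples k)) * D0 / mu" using mu_pos by (simp add: field_simps)
  have "E \<le> mu\<^sup>2 / L\<^sup>2 * (2 * real (card (samples k)) * D0 / mu)"
    using ER \<kappa>L R0 1 by (intro order.trans[OF ER] mult_mono) auto
  also have "\<dots> = 2 * mu * real (card (samples k)) * D0 / L\<^sup>2"
    using mu_pos by (simp add: power2_eq_square)
  finally show "E \<le> 2 * mu * real (card (samples k)) * D0 / L\<^sup>2" .
qed

text \<open>Common form of the four estimates: \<open>a\<close> weighs the distance from the
  prox-centre to the subproblem solution, \<open>b\<close> the error of the computed iterate. The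
  uniform law on the product makes the expectation a plain average.\<close>

lemma expectation_bound:
  assumes opt: "xstar \<in> X" "A xstar + xmstar = bv"
      "\<forall>x\<in>X. \<forall>xm. A x + xm = bv \<longrightarrow> F xstar + fm xmstar \<le> F x + fm xm"
    and init: "x0 \<in> X" "A x0 + xm0 = bv" and k: "1 \<le> k" and ab: "0 \<le> a" "0 \<le> b"
    and h: "\<And>\<omega> l. h (\<omega>, Suc l) \<le> a * sqdist (outer_run x0 xm0 \<omega> l) (sub_sol (outer_run x0 xm0 \<omega> l))
        + b * sqdist (outer_run x0 xm0 \<omega> (Suc l)) (sub_sol (outer_run x0 xm0 \<omega> l))"
  shows "measure_pmf.expectation (pmf_of_set (samples k \<times> {1..k})) h
    \<le> (2 * a / mu + 2 * b * mu / L\<^sup>2) / k * (F x0 + fm xm0 - (F xstar + fm xmstar))"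
proof -
  define D0 where "D0 = F x0 + fm xm0 - (F xstar + fm xmstar)"
  define C where "C = real (card (samples k))"
  have fin: "finite (samples k)" by (intro finite_PiE) auto
  have ne: "samples k \<noteq> {}" using m3 by (auto simp: PiE_eq_empty_iff)
  have C: "0 < C" using fin ne by (simp add: C_def card_gt_0_iff)
  have k0: "0 < real k" using k by simp
  have "(\<Sum>p\<in>samples k \<times> {1..k}. h p) = (\<Sum>\<omega>\<in>samples k. \<Sum>l=1..k. h (\<omega>, l))"
    by (simp add: sum.cartesian_product)
  also have "\<dots> = (\<Sum>\<omega>\<in>samples k. \<Sum>l<k. h (\<omega>, Suc l))"
    unfolding One_nat_def by (simp add: sum.atLeast1_atMost_eq)
  also have "\<dots> \<le> (\<Sum>\<omega>\<in>samples k. \<Sum>l<k. a * sqdist (outer_run x0 xm0 \<omega> l) (sub_sol (outer_run x0 xm0 \<omega> l))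
        + b * sqdist (outer_run x0 xm0 \<omega> (Suc l)) (sub_sol (outer_run x0 xm0 \<omega> l)))"
    by (intro sum_mono h)
  also have "\<dots> \<le> a * (2 * C * D0 / mu) + b * (2 * mu * C * D0 / L\<^sup>2)"
    unfolding sum.distrib sum_distrib_left[symmetric] C_def D0_def
    using ab by (intro add_mono mult_left_mono outer_sums(1,2)[OF opt init k])
  also have "\<dots> = (2 * a / mu + 2 * b * mu / L\<^sup>2) * D0 * C"
    by (simp add: algebra_simps)
  finally have sum_le: "(\<Sum>p\<in>samples k \<times> {1..k}. h p) \<le> (2 * a / mu + 2 * b * mu / L\<^sup>2) * D0 * C" .
  have "measure_pmf.expectation (pmf_of_set (samples k \<times> {1..k})) h = (\<Sum>p\<in>samples k \<times> {1..k}. h p) / (C * k)"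
    using fin ne k by (subst integral_pmf_of_set) (auto simp: card_cartesian_product C_def)
  also have "\<dots> \<le> (2 * a / mu + 2 * b * mu / L\<^sup>2) * D0 * C / (C * k)"
    using sum_le C by (intro divide_right_mono) auto
  also have "\<dots> = (2 * a / mu + 2 * b * mu / L\<^sup>2) / k * D0" using C by simp
  finally show ?thesis by (simp add: D0_def)
qed

end

theorem theorem3:
  fixes m k :: nat
    and B :: "nat \<Rightarrow> 'a::euclidean_space set"
    and Xs :: "nat \<Rightarrow> 'a set"
    and A :: "'a \<Rightarrow> 'b::euclidean_space"
    and bv :: 'b
    and f :: "nat \<Rightarrow> 'a \<Rightarrow> real" and gf :: "nat \<Rightarrow> 'a \<Rightarrow> 'a"
    and fm :: "'b \<Rightarrow> real" and gfm :: "'b \<Rightarrow> 'b"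
    and mu L :: real
    and xstar x0 :: 'a and xmstar xm0 :: 'b
  assumes m3: "m \<ge> 3"
    and B_sub: "\<forall>i\<in>{1..m-1}. B i \<subseteq> Basis"
    and B_disj: "\<forall>i\<in>{1..m-1}. \<forall>j\<in>{1..m-1}. i \<noteq> j \<longrightarrow> B i \<inter> B j = {}"
    and B_cover: "(\<Union>i\<in>{1..m-1}. B i) = Basis"
    and X_sub: "\<forall>i\<in>{1..m-1}. Xs i \<subseteq> span (B i)"
    and X_ne: "\<forall>i\<in>{1..m-1}. Xs i \<noteq> {}"
    and X_closed: "\<forall>i\<in>{1..m-1}. closed (Xs i)"
    and X_convex: "\<forall>i\<in>{1..m-1}. convex (Xs i)"
    and A_lin: "linear A"
    and mu_pos: "0 < mu" and mu_le_L: "mu \<le> L"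
    and f_grad: "\<forall>i\<in>{1..m-1}. \<forall>x\<in>Xs i. gf i x \<in> span (B i) \<and>
                   (f i has_derivative (\<lambda>h. gf i x \<bullet> h)) (at x within span (B i))"
    and f_weak: "\<forall>i\<in>{1..m-1}. \<forall>x\<in>Xs i. \<forall>y\<in>Xs i.
                   f i x - f i y - gf i y \<bullet> (x - y) \<ge> - (mu / 2) * (norm (x - y))\<^sup>2"
    and fm_grad: "\<forall>x. (fm has_derivative (\<lambda>h. gfm x \<bullet> h)) (at x)"
    and fm_weak: "\<forall>x y. fm x - fm y - gfm y \<bullet> (x - y) \<ge> - (mu / 2) * (norm (x - y))\<^sup>2"
    and fm_lip: "\<forall>x y. norm (gfm x - gfm y) \<le> L * norm (x - y)"
    and opt_feas: "xstar \<in> prodX m B Xs" "A xstar + xmstar = bv"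
    and opt_min: "\<forall>x\<in>prodX m B Xs. \<forall>xm. A x + xm = bv \<longrightarrow>
                    fsum m B f xstar + fm xmstar \<le> fsum m B f x + fm xm"
    and init: "x0 \<in> prodX m B Xs" "A x0 + xm0 = bv"
    and k_pos: "k \<ge> 1"
  shows
    "let \<alpha> = rap_alpha m mu L (Abar m B A);
         s = rap_s mu L \<alpha>;
         run = rapdual m B Xs A bv f fm gfm mu ((real m - 1) * \<alpha>) (rap_tau \<alpha>) (rap_eta m mu \<alpha>)
                 s x0 xm0;
         xbar = (\<lambda>\<omega> l. fst (run \<omega> l));
         xmbar = (\<lambda>\<omega> l. snd (run \<omega> l));
         xsub = (\<lambda>\<omega> l. fst (sub_opt m B Xs A bv f fm mu (xbar \<omega> (l - 1)) (xmbar \<omega> (l - 1))));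
         P = pmf_of_set ((({1..k} \<times> {1..s}) \<rightarrow>\<^sub>E {1..m-1}) \<times> {1..k});
         D0 = fsum m B f x0 + fm xm0 - (fsum m B f xstar + fm xmstar)
     in \<exists>lam :: (nat \<times> nat \<Rightarrow> nat) \<times> nat \<Rightarrow> 'b.
          measure_pmf.expectation P
            (\<lambda>(\<omega>, l). (infdist (gsum m B gf (xsub \<omega> l) + adjoint A (lam (\<omega>, l)))
                                 (uminus ` normal_cone (prodX m B Xs) (xsub \<omega> l)))\<^sup>2)
            \<le> 8 * mu / k * D0
        \<and> measure_pmf.expectation P
            (\<lambda>(\<omega>, l). (norm (gfm (xmbar \<omega> l) + lam (\<omega>, l)))\<^sup>2) \<le> 34 * mu / k * D0
        \<and> measure_pmf.expectation P
            (\<lambda>(\<omega>, l). (norm (xbar \<omega> l - xsub \<omega> l))\<^sup>2) \<le> 2 * mu / (k * L\<^sup>2) * D0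
        \<and> measure_pmf.expectation P
            (\<lambda>(\<omega>, l). (norm (A (xbar \<omega> l) + xmbar \<omega> l - bv))\<^sup>2)
            \<le> 2 * ((onorm A)\<^sup>2 + 1) * mu / (k * L\<^sup>2) * D0"
proof -
  interpret rap_setting m B Xs A bv f gf fm gfm mu L
    by (rule rap_setting.intro[OF m3 B_sub B_disj B_cover X_sub X_ne X_closed X_convex A_lin mu_pos mu_le_L
          f_grad f_weak fm_grad fm_weak fm_lip])
  \<comment> \<open>Outer index l refers to the subproblem centred at iterate l - 1.\<close>
  define lam where "lam p = multiplier (outer_run x0 xm0 (fst p) (snd p - 1))" for p :: "(nat \<times> nat \<Rightarrow> nat) \<times> nat"
  note bound = expectation_bound[OF opt_feas opt_min init k_pos]
  have D0: "0 \<le> F x0 + fm xm0 - (F xstar + fm xmstar)"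
    using outer_sums(3)[OF opt_feas opt_min init k_pos] .
  have L: "0 < L" using mu_pos mu_le_L by simp
  have "measure_pmf.expectation (pmf_of_set (samples k \<times> {1..k}))
      (\<lambda>(\<omega>, l). (infdist (G (fst (sub_sol (outer_run x0 xm0 \<omega> (l - 1)))) + adjoint A (lam (\<omega>, l)))
        (uminus ` normal_cone X (fst (sub_sol (outer_run x0 xm0 \<omega> (l - 1))))))\<^sup>2)
      \<le> (2 * (4 * mu\<^sup>2) / mu + 2 * 0 * mu / L\<^sup>2) / k * (F x0 + fm xm0 - (F xstar + fm xmstar))"
    using stationarity by (intro bound) (auto simp: lam_def)
  also have "2 * (4 * mu\<^sup>2) / mu + 2 * 0 * mu / L\<^sup>2 = 8 * mu" using mu_pos by (simp add: power2_eq_square)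
  finally have 1: "measure_pmf.expectation (pmf_of_set (samples k \<times> {1..k}))
      (\<lambda>(\<omega>, l). (infdist (G (fst (sub_sol (outer_run x0 xm0 \<omega> (l - 1)))) + adjoint A (lam (\<omega>, l)))
        (uminus ` normal_cone X (fst (sub_sol (outer_run x0 xm0 \<omega> (l - 1))))))\<^sup>2)
      \<le> 8 * mu / k * (F x0 + fm xm0 - (F xstar + fm xmstar))" .
  have "measure_pmf.expectation (pmf_of_set (samples k \<times> {1..k}))
      (\<lambda>(\<omega>, l). (norm (gfm (snd (outer_run x0 xm0 \<omega> l)) + lam (\<omega>, l)))\<^sup>2)
      \<le> (2 * (8 * mu\<^sup>2) / mu + 2 * (2 * L\<^sup>2) * mu / L\<^sup>2) / k * (F x0 + fm xm0 - (F xstar + fm xmstar))"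
  proof (rule bound)
    fix \<omega> l
    show "(case (\<omega>, Suc l) of (\<omega>, l) \<Rightarrow> (norm (gfm (snd (outer_run x0 xm0 \<omega> l)) + lam (\<omega>, l)))\<^sup>2)
      \<le> 8 * mu\<^sup>2 * sqdist (outer_run x0 xm0 \<omega> l) (sub_sol (outer_run x0 xm0 \<omega> l))
        + 2 * L\<^sup>2 * sqdist (outer_run x0 xm0 \<omega> (Suc l)) (sub_sol (outer_run x0 xm0 \<omega> l))"
      using multiplier_residual[of "snd (outer_run x0 xm0 \<omega> (Suc l))" "outer_run x0 xm0 \<omega> l" "fst (outer_run x0 xm0 \<omega> (Suc l))"]
      by (simp add: lam_def)
  qed auto
  also have "\<dots> \<le> 34 * mu / k * (F x0 + fm xm0 - (F xstar + fm xmstar))"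
  proof -
    \<comment> \<open>The two contributions are 16 * mu and 4 * mu, within the claimed 34 * mu;
      enlarging the constant uses that the initial gap is nonnegative.\<close>
    have "2 * (8 * mu\<^sup>2) / mu + 2 * (2 * L\<^sup>2) * mu / L\<^sup>2 = 20 * mu"
      using mu_pos L by (simp add: power2_eq_square)
    then show ?thesis using mu_pos D0 by (intro mult_right_mono divide_right_mono) auto
  qed
  finally have 2: "measure_pmf.expectation (pmf_of_set (samples k \<times> {1..k}))
      (\<lambda>(\<omega>, l). (norm (gfm (snd (outer_run x0 xm0 \<omega> l)) + lam (\<omega>, l)))\<^sup>2)
      \<le> 34 * mu / k * (F x0 + fm xm0 - (F xstar + fm xmstar))" .
  have "measure_pmf.expectation (pmf_of_set (samples k \<times> {1..k}))
      (\<lambda>(\<omega>, l). (norm (fst (outer_run x0 xm0 \<omega> l) - fst (sub_sol (outer_run x0 xm0 \<omega> (l - 1)))))\<^sup>2)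
      \<le> (2 * 0 / mu + 2 * 1 * mu / L\<^sup>2) / k * (F x0 + fm xm0 - (F xstar + fm xmstar))"
    by (rule bound) (auto simp: sqdist_def)
  then have 3: "measure_pmf.expectation (pmf_of_set (samples k \<times> {1..k}))
      (\<lambda>(\<omega>, l). (norm (fst (outer_run x0 xm0 \<omega> l) - fst (sub_sol (outer_run x0 xm0 \<omega> (l - 1)))))\<^sup>2)
      \<le> 2 * mu / (k * L\<^sup>2) * (F x0 + fm xm0 - (F xstar + fm xmstar))"
    by (simp add: mult.commute)
  have "measure_pmf.expectation (pmf_of_set (samples k \<times> {1..k}))
      (\<lambda>(\<omega>, l). (norm (A (fst (outer_run x0 xm0 \<omega> l)) + snd (outer_run x0 xm0 \<omega> l) - bv))\<^sup>2)
      \<le> (2 * 0 / mu + 2 * ((onorm A)\<^sup>2 + 1) * mu / L\<^sup>2) / k * (F x0 + fm xm0 - (F xstar + fm xmstar))"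
  proof (rule bound)
    fix \<omega> l
    show "(case (\<omega>, Suc l) of (\<omega>, l) \<Rightarrow> (norm (A (fst (outer_run x0 xm0 \<omega> l)) + snd (outer_run x0 xm0 \<omega> l) - bv))\<^sup>2)
      \<le> 0 * sqdist (outer_run x0 xm0 \<omega> l) (sub_sol (outer_run x0 xm0 \<omega> l))
        + ((onorm A)\<^sup>2 + 1) * sqdist (outer_run x0 xm0 \<omega> (Suc l)) (sub_sol (outer_run x0 xm0 \<omega> l))"
      using feasibility_residual[of "fst (outer_run x0 xm0 \<omega> (Suc l))" "snd (outer_run x0 xm0 \<omega> (Suc l))" "outer_run x0 xm0 \<omega> l"]
      by simp
  qed auto
  then have 4: "measure_pmf.expectation (pmf_of_set (samples k \<times> {1..k}))
      (\<lambda>(\<omega>, l). (norm (A (fst (outer_run x0 xm0 \<omega> l)) + snd (outer_run x0 xm0 \<omega> l) - bv))\<^sup>2)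
      \<le> 2 * ((onorm A)\<^sup>2 + 1) * mu / (k * L\<^sup>2) * (F x0 + fm xm0 - (F xstar + fm xmstar))"
    by (simp add: mult.commute)
  show ?thesis
    unfolding Let_def
    using 1 2 3 4 unfolding sub_sol_def outer_run_def by (intro exI[of _ lam] conjI)
qed

end
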